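(* Let $\succsim$ be a preference relation on $\mathcal X$. Then $\succsim$ satisfies Axioms (RC), (M), (SRM), (C) and (CI) if and only if there exist a strictly increasing continuous distortion function $g$ and a continuous risk-conforming capacity $\nu$ such that $$X\succsim Y\iff\int_\Omega X\,\mathrm d(g\circ\nu)\ \ge\ \int_\Omega Y\,\mathrm d(g\circ\nu),\qquad X,Y\in\mathcal X.$$ Moreover, in this representation $g$ is unique, and $\nu$ is unique and coincides with the $\succsim$-matching probability.
   Context: Setting. $(\Omega,\mathcal F)$ is a measurable space, $\mathcal G\subseteq\mathcal F$ is a sub-$\sigma$-algebra, and $\mathbb P:\mathcal G\to[0,1]$ is a (countably additive) probability measure that is atomless: $\{\mathbb P(B):B\in\mathcal G,\,B\subseteq A\}=[0,\mathbb P(A)]$ for every $A\in\mathcal G$. An act is a bounded $\mathcal F$-measurable function $X:\Omega\to\mathbb R$; $\mathcal X$ is the set of acts, $\mathcal X(\mathcal G)$ the set of $\mathcal G$-measurable acts. A preference relation $\succsim$ is a total preorder on $\mathcal X$; $\succ$ and $\simeq$ are its strict and symmetric parts. A capacity is $\nu:\mathcal F\to\mathbb R$ with $\nu(\varnothing)=0$, $\nu(\Omega)=1$, and $\nu(A)\le\nu(B)$ whenever $A\subseteq B$. It is continuous if $\nu(A_n)\to\nu(\bigcup_n A_n)$ for increasing sequences and $\nu(A_n)\to\nu(\bigcap_n A_n)$ for decreasing sequences. It is risk conforming if $\nu|_{\mathcal G}=\mathbb P$. A distortion function is an increasing $g:[0,1]\to[0,1]$ with $g(0)=0$, $g(1)=1$.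 The Choquet integral is $\int X\,\mathrm d\nu=\int_0^\infty\nu(X>x)\,\mathrm dx+\int_{-\infty}^0(\nu(X>x)-1)\,\mathrm dx$. Acts $X,Y$ are comonotonic if $(X(\omega)-X(\tilde\omega))(Y(\omega)-Y(\tilde\omega))\ge0$ for all $\omega,\tilde\omega\in\Omega$. Axioms. (RC) If $X,Y\in\mathcal X(\mathcal G)$ and $\mathbb P(X>x)=\mathbb P(Y>x)$ for all $x\in\mathbb R$, then $X\simeq Y$. (M) If $X,Y\in\mathcal X$ and $X(\omega)\ge Y(\omega)$ for all $\omega$, then $X\succsim Y$. (SRM) If $X,Y\in\mathcal X(\mathcal G)$, $\mathbb P(X\ge Y)=1$ and $\mathbb P(X>Y)>0$, then $X\succ Y$. (C) For all $X\in\mathcal X$, the sets $\{Y\in\mathcal X:X\succsim Y\}$ and $\{Y\in\mathcal X:Y\succsim X\}$ are B-closed, where $\mathcal S\subseteq\mathcal X$ is B-closed if whenever $(X_n)_{n\in\mathbb N}\subseteq\mathcal S$ satisfies $\sup_n\sup_\omega|X_n(\omega)|<\infty$ and $X_n\to X\in\mathcal X$ pointwise, then $X\in\mathcal S$. (CI) For all pairwise comonotonic $X,Y,Z\in\mathcal X$: $X\simeq Y$ implies $(1/2)X+(1/2)Z\simeq(1/2)Y+(1/2)Z$. A $\succsim$-matching probability is a function $\nu:\mathcal F\to[0,1]$ such that for every $A\in\mathcal F$ there is $R_A\in\mathcal G$ with $\nu(A)=\mathbb P(R_A)$ and $\mathbf 1_A\simeq\mathbf 1_{R_A}$. Under (RC),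 (M), (SRM), (C) it exists and is unique. *)

theory Defs
  imports "HOL-Probability.Probability"
begin

text \<open>
  The measurable space \<open>(\<Omega>, \<F>)\<close> is given by \<open>space M\<close> and \<open>sets M\<close>; the measure carried by
  \<open>M\<close> is never used.  The measure \<open>P\<close> carries both the sub-\<open>\<sigma>\<close>-algebra \<open>\<G> = sets P\<close> and the
  probability on it, so that \<open>acts P\<close> is the set of \<open>\<G>\<close>-measurable acts.  Functions on \<open>\<Omega>\<close>,
  \<open>\<F>\<close> and \<open>[0,1]\<close> are total functions of which only the values on \<open>space M\<close>, \<open>sets M\<close> and
  \<open>{0..1}\<close> matter.
\<close>

definition atomless :: "'a measure \<Rightarrow> bool" where
  "atomless P \<longleftrightarrow>
     (\<forall>A\<in>sets P. {measure P B | B. B \<in> sets P \<and> B \<subseteq> A} = {0..measure P A})"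

definition acts :: "'a measure \<Rightarrow> ('a \<Rightarrow> real) set" where
  "acts M = {X \<in> borel_measurable M. bounded (X ` space M)}"

type_synonym 'a pref = "('a \<Rightarrow> real) \<Rightarrow> ('a \<Rightarrow> real) \<Rightarrow> bool"

definition preference_relation :: "'a measure \<Rightarrow> 'a pref \<Rightarrow> bool" where
  "preference_relation M pref \<longleftrightarrow>
     reflp_on (acts M) pref \<and> transp_on (acts M) pref \<and> totalp_on (acts M) pref"

definition strictly_preferred :: "'a pref \<Rightarrow> 'a pref" where
  "strictly_preferred pref X Y \<longleftrightarrow> pref X Y \<and> \<not> pref Y X"

definition indifferent :: "'a pref \<Rightarrow> 'a pref" where
  "indifferent pref X Y \<longleftrightarrow> pref X Y \<and> pref Y X"

definition capacity :: "'a measure \<Rightarrow> ('a set \<Rightarrow> real) \<Rightarrow> bool" where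
  "capacity M \<nu> \<longleftrightarrow>
     \<nu> {} = 0 \<and> \<nu> (space M) = 1 \<and>
     (\<forall>A\<in>sets M. \<forall>B\<in>sets M. A \<subseteq> B \<longrightarrow> \<nu> A \<le> \<nu> B)"

definition continuous_capacity :: "'a measure \<Rightarrow> ('a set \<Rightarrow> real) \<Rightarrow> bool" where
  "continuous_capacity M \<nu> \<longleftrightarrow>
     capacity M \<nu> \<and>
     (\<forall>A :: nat \<Rightarrow> 'a set. range A \<subseteq> sets M \<and> incseq A \<longrightarrow>
        (\<lambda>n. \<nu> (A n)) \<longlonglongrightarrow> \<nu> (\<Union>n. A n)) \<and>
     (\<forall>A :: nat \<Rightarrow> 'a set. range A \<subseteq> sets M \<and> decseq A \<longrightarrow>
        (\<lambda>n. \<nu> (A n)) \<longlonglongrightarrow> \<nu> (\<Inter>n. A n))"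

definition risk_conforming :: "'a measure \<Rightarrow> ('a set \<Rightarrow> real) \<Rightarrow> bool" where
  "risk_conforming P \<nu> \<longleftrightarrow> (\<forall>A\<in>sets P. \<nu> A = measure P A)"

definition distortion_function :: "(real \<Rightarrow> real) \<Rightarrow> bool" where
  "distortion_function g \<longleftrightarrow>
     g \<in> {0..1} \<rightarrow> {0..1} \<and> mono_on {0..1} g \<and> g 0 = 0 \<and> g 1 = 1"

definition choquet_integral :: "'a measure \<Rightarrow> ('a set \<Rightarrow> real) \<Rightarrow> ('a \<Rightarrow> real) \<Rightarrow> real" where
  "choquet_integral M \<nu> X =
     (LINT x:{0..}|lborel. \<nu> {\<omega>\<in>space M. X \<omega> > x}) +
     (LINT x:{..0}|lborel. (\<nu> {\<omega>\<in>space M. X \<omega> > x} - 1))"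

definition comonotonic :: "'a measure \<Rightarrow> ('a \<Rightarrow> real) \<Rightarrow> ('a \<Rightarrow> real) \<Rightarrow> bool" where
  "comonotonic M X Y \<longleftrightarrow>
     (\<forall>\<omega>\<in>space M. \<forall>\<omega>'\<in>space M. (X \<omega> - X \<omega>') * (Y \<omega> - Y \<omega>') \<ge> 0)"

definition axiom_RC :: "'a measure \<Rightarrow> 'a pref \<Rightarrow> bool" where
  "axiom_RC P pref \<longleftrightarrow>
     (\<forall>X\<in>acts P. \<forall>Y\<in>acts P.
        (\<forall>x. measure P {\<omega>\<in>space P. X \<omega> > x} = measure P {\<omega>\<in>space P. Y \<omega> > x}) \<longrightarrow>
        indifferent pref X Y)"

definition axiom_M :: "'a measure \<Rightarrow> 'a pref \<Rightarrow> bool" where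
  "axiom_M M pref \<longleftrightarrow>
     (\<forall>X\<in>acts M. \<forall>Y\<in>acts M. (\<forall>\<omega>\<in>space M. X \<omega> \<ge> Y \<omega>) \<longrightarrow> pref X Y)"

definition axiom_SRM :: "'a measure \<Rightarrow> 'a pref \<Rightarrow> bool" where
  "axiom_SRM P pref \<longleftrightarrow>
     (\<forall>X\<in>acts P. \<forall>Y\<in>acts P.
        measure P {\<omega>\<in>space P. X \<omega> \<ge> Y \<omega>} = 1 \<and> measure P {\<omega>\<in>space P. X \<omega> > Y \<omega>} > 0 \<longrightarrow>
        strictly_preferred pref X Y)"

definition B_closed :: "'a measure \<Rightarrow> ('a \<Rightarrow> real) set \<Rightarrow> bool" where
  "B_closed M S \<longleftrightarrow>
     (\<forall>Xs :: nat \<Rightarrow> 'a \<Rightarrow> real. \<forall>X\<in>acts M.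
        (\<forall>n. Xs n \<in> S) \<and> bounded (\<Union>n. Xs n ` space M) \<and>
        (\<forall>\<omega>\<in>space M. (\<lambda>n. Xs n \<omega>) \<longlonglongrightarrow> X \<omega>) \<longrightarrow>
        X \<in> S)"

definition axiom_C :: "'a measure \<Rightarrow> 'a pref \<Rightarrow> bool" where
  "axiom_C M pref \<longleftrightarrow>
     (\<forall>X\<in>acts M. B_closed M {Y\<in>acts M. pref X Y} \<and> B_closed M {Y\<in>acts M. pref Y X})"

definition axiom_CI :: "'a measure \<Rightarrow> 'a pref \<Rightarrow> bool" where
  "axiom_CI M pref \<longleftrightarrow>
     (\<forall>X\<in>acts M. \<forall>Y\<in>acts M. \<forall>Z\<in>acts M.
        comonotonic M X Y \<and> comonotonic M X Z \<and> comonotonic M Y Z \<longrightarrow>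
        indifferent pref X Y \<longrightarrow>
        indifferent pref (\<lambda>\<omega>. (1/2) * X \<omega> + (1/2) * Z \<omega>) (\<lambda>\<omega>. (1/2) * Y \<omega> + (1/2) * Z \<omega>))"

definition matching_probability ::
    "'a measure \<Rightarrow> 'a measure \<Rightarrow> 'a pref \<Rightarrow> ('a set \<Rightarrow> real) \<Rightarrow> bool" where
  "matching_probability M P pref \<nu> \<longleftrightarrow>
     \<nu> \<in> sets M \<rightarrow> {0..1} \<and>
     (\<forall>A\<in>sets M. \<exists>R\<in>sets P.
        \<nu> A = measure P R \<and> indifferent pref (indicator A) (indicator R))"

definition choquet_representation ::
    "'a measure \<Rightarrow> 'a measure \<Rightarrow> 'a pref \<Rightarrow> (real \<Rightarrow> real) \<Rightarrow> ('a set \<Rightarrow> real) \<Rightarrow> bool" where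
  "choquet_representation M P pref g \<nu> \<longleftrightarrow>
     distortion_function g \<and> strict_mono_on {0..1} g \<and> continuous_on {0..1} g \<and>
     continuous_capacity M \<nu> \<and> risk_conforming P \<nu> \<and>
     (\<forall>X\<in>acts M. \<forall>Y\<in>acts M.
        pref X Y \<longleftrightarrow> choquet_integral M (g \<circ> \<nu>) X \<ge> choquet_integral M (g \<circ> \<nu>) Y)"

end

theory Submission
  imports Defs
begin

text \<open>
  From a representation to the axioms, the two substantial points are (C) and (CI).  For a continuous
  capacity, bounded pointwise convergence of \<open>X\<^sub>n\<close> to \<open>X\<close> gives convergence of the survival functions at
  every continuity point of the limit, hence of the integrals by dominated convergence.  For (CI) one
  needs additivity of the integral on comonotonic \<open>X\<close>, \<open>Z\<close>: with \<open>W = X + Z\<close> there are increasing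
  1-Lipschitz \<open>u\<close>, \<open>v\<close> with \<open>X = u(W)\<close>, \<open>Z = v(W)\<close>, \<open>u + v = id\<close>, and continuity of the capacity makes
  \<open>w \<mapsto> 1 - \<mu>(W > w)\<close> the distribution function of a probability \<open>N\<close> on the line.  Since \<open>u\<close> and \<open>v\<close> are
  increasing, the Choquet integrals of \<open>X\<close>, \<open>Z\<close> and \<open>W\<close> are the \<open>N\<close>-expectations of \<open>u\<close>, \<open>v\<close> and \<open>id\<close>.

  Conversely, the axioms give every act a unique certainty equivalent.  It represents the preference,
  is continuous along bounded pointwise limits by (C), and additive on comonotonic acts by (CI), so it
  is determined by its values \<open>\<mu>(A)\<close> on indicators: every act is a bounded pointwise limit of sums of
  comonotonic multiples of indicators of its upper level sets.  The Choquet integral of \<open>\<mu>\<close> has the same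
  properties, so the two functionals agree.  On \<open>\<G>\<close>, (RC) gives \<open>\<mu> = g \<circ> P\<close>, where \<open>g\<close> is strictly
  increasing by (SRM) and continuous by atomlessness, and \<open>\<nu> = g\<^sup>-\<^sup>1 \<circ> \<mu>\<close>.
\<close>

section \<open>The Choquet integral of bounded functions\<close>

abbreviation survival :: "'a measure \<Rightarrow> ('a set \<Rightarrow> real) \<Rightarrow> ('a \<Rightarrow> real) \<Rightarrow> real \<Rightarrow> real" where
  "survival M \<mu> X x \<equiv> \<mu> {\<omega>\<in>space M. X \<omega> > x}"

lemma acts_iff:
  "X \<in> acts M \<longleftrightarrow> X \<in> borel_measurable M \<and> (\<exists>B>0. \<forall>\<omega>\<in>space M. \<bar>X \<omega>\<bar> \<le> B)"
  unfolding acts_def bounded_pos by auto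

lemma actsI:
  "X \<in> borel_measurable M \<Longrightarrow> (\<And>\<omega>. \<omega> \<in> space M \<Longrightarrow> \<bar>X \<omega>\<bar> \<le> B) \<Longrightarrow> X \<in> acts M"
  unfolding acts_iff by (metis dual_order.trans linorder_not_le zero_less_one less_eq_real_def)

lemma actsE:
  assumes "X \<in> acts M"
  obtains B where "B > 0" "\<And>\<omega>. \<omega> \<in> space M \<Longrightarrow> \<bar>X \<omega>\<bar> \<le> B"
  using assms unfolding acts_iff by blast

lemma acts_measurable [measurable_dest]: "X \<in> acts M \<Longrightarrow> X \<in> borel_measurable M"
  unfolding acts_def by simp

lemma const_acts [simp]: "(\<lambda>_. c) \<in> acts M"
  by (rule actsI[of _ _ "\<bar>c\<bar>"]) auto

lemma indicator_acts: "A \<in> sets M \<Longrightarrow> indicator A \<in> acts M"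
  by (rule actsI[of _ _ 1]) (auto simp: indicator_def)

lemma add_acts:
  assumes "X \<in> acts M" "Y \<in> acts M"
  shows "(\<lambda>\<omega>. X \<omega> + Y \<omega>) \<in> acts M"
proof -
  note [measurable] = assms
  obtain B C where "\<And>\<omega>. \<omega> \<in> space M \<Longrightarrow> \<bar>X \<omega>\<bar> \<le> B" "\<And>\<omega>. \<omega> \<in> space M \<Longrightarrow> \<bar>Y \<omega>\<bar> \<le> C"
    using assms by (metis actsE)
  then show ?thesis
    by (intro actsI[of _ _ "B + C"]) (auto intro: order.trans[OF abs_triangle_ineq] add_mono)
qed

lemma scale_acts:
  assumes "X \<in> acts M"
  shows "(\<lambda>\<omega>. c * X \<omega>) \<in> acts M"
proof -
  note [measurable] = assms
  obtain B where "\<And>\<omega>. \<omega> \<in> space M \<Longrightarrow> \<bar>X \<omega>\<bar> \<le> B"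
    using assms by (metis actsE)
  then show ?thesis
    by (intro actsI[of _ _ "\<bar>c\<bar> * B"]) (auto simp: abs_mult mult_left_mono)
qed

lemma capacity_mono:
  "capacity M \<mu> \<Longrightarrow> A \<in> sets M \<Longrightarrow> B \<in> sets M \<Longrightarrow> A \<subseteq> B \<Longrightarrow> \<mu> A \<le> \<mu> B"
  unfolding capacity_def by blast

lemma capacity_bounds:
  assumes "capacity M \<mu>" "A \<in> sets M"
  shows "0 \<le> \<mu> A" "\<mu> A \<le> 1"
  using capacity_mono[OF assms(1), of "{}" A] capacity_mono[OF assms(1), of A "space M"]
    assms sets.sets_into_space unfolding capacity_def by auto

lemma sets_greater [measurable (raw)]:
  "X \<in> borel_measurable M \<Longrightarrow> {\<omega>\<in>space M. (x::real) < X \<omega>} \<in> sets M"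
  by measurable

context
  fixes M :: "'a measure" and \<mu> :: "'a set \<Rightarrow> real"
  assumes cap: "capacity M \<mu>"
begin

lemma survival_bounds:
  assumes "X \<in> borel_measurable M"
  shows "0 \<le> survival M \<mu> X x" "survival M \<mu> X x \<le> 1"
  using capacity_bounds[OF cap] sets_greater[OF assms] by auto

lemma survival_antimono:
  assumes "X \<in> borel_measurable M" "x \<le> y"
  shows "survival M \<mu> X y \<le> survival M \<mu> X x"
  using assms by (intro capacity_mono[OF cap]) auto

lemma survival_measurable:
  assumes "X \<in> borel_measurable M"
  shows "survival M \<mu> X \<in> borel_measurable borel"
proof -
  have "(\<lambda>x. - survival M \<mu> X x) \<in> borel_measurable borel"
    by (rule borel_measurable_mono) (auto simp: mono_def intro: survival_antimono assms)
  then show ?thesis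
    using borel_measurable_uminus_eq by blast
qed

lemma survival_integrable:
  assumes "X \<in> borel_measurable M"
  shows "set_integrable lborel {a..b} (survival M \<mu> X)"
proof -
  have "set_integrable lborel {a..b} (\<lambda>_. 1 :: real)"
    by (auto simp: set_integrable_def emeasure_lborel_Icc_eq)
  then show ?thesis
    using survival_measurable[OF assms] survival_bounds[OF assms]
    by (rule_tac set_integrable_bound[where f = "\<lambda>_. 1::real"])
      (auto simp: set_borel_measurable_def)
qed

lemma survival_above:
  assumes "\<And>\<omega>. \<omega> \<in> space M \<Longrightarrow> X \<omega> \<le> x"
  shows "survival M \<mu> X x = 0"
proof -
  have "{\<omega>\<in>space M. X \<omega> > x} = {}"
    using assms by force
  then show ?thesis
    using cap unfolding capacity_def by metis
qed

lemma survival_below: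
  assumes "\<And>\<omega>. \<omega> \<in> space M \<Longrightarrow> X \<omega> > x"
  shows "survival M \<mu> X x = 1"
proof -
  have "{\<omega>\<in>space M. X \<omega> > x} = space M"
    using assms by force
  then show ?thesis
    using cap by (simp add: capacity_def)
qed

text \<open>Outside \<open>[-B, B]\<close> the survival function is 0 or 1, so both half-line
  integrals reduce to bounded intervals, and the constant 1 subtracted on \<open>[-B, 0]\<close>
  contributes \<open>B\<close>. With a common bound, several acts can be compared over one
  interval.\<close>

lemma choquet_bounded:
  assumes X: "X \<in> borel_measurable M" and B: "\<And>\<omega>. \<omega> \<in> space M \<Longrightarrow> \<bar>X \<omega>\<bar> \<le> B" and "0 \<le> B"
  shows "choquet_integral M \<mu> X = (LINT x:{-B..B}|lborel. survival M \<mu> X x) - B"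
proof -
  let ?S = "survival M \<mu> X"
  \<comment> \<open>\<open>X\<close> may attain \<open>-B\<close>, so the value 1 is certain only
    for \<open>x < -B\<close>, while the value 0 starts at \<open>B\<close> itself.\<close>
  have above: "?S x = 0" if "B \<le> x" for x
    using that B by (intro survival_above) force
  have below: "?S x = 1" if "x < - B" for x
    using that B by (intro survival_below) force
  have 1: "(LINT x:{0..}|lborel. ?S x) = (LINT x:{0..B}|lborel. ?S x)"
    unfolding set_lebesgue_integral_def
    using above by (intro Bochner_Integration.integral_cong) (auto simp: indicator_def)
  have "(LINT x:{..0}|lborel. ?S x - 1) = (LINT x:{-B..0}|lborel. ?S x - 1)"
    unfolding set_lebesgue_integral_def
    using below by (intro Bochner_Integration.integral_cong) (auto simp: indicator_def)
  also have "\<dots> = (LINT x:{-B..0}|lborel. ?S x) - (LINT x:{-B..0}|lborel. 1)"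
    by (intro set_integral_diff survival_integrable X) (auto simp: set_integrable_def emeasure_lborel_Icc_eq)
  also have "(LINT x:{-B..0}|lborel. 1) = B"
    using \<open>0 \<le> B\<close> by (simp add: set_lebesgue_integral_def)
  finally have 2: "(LINT x:{..0}|lborel. ?S x - 1) = (LINT x:{-B..0}|lborel. ?S x) - B" .
  \<comment> \<open>The two intervals overlap only in the null set \<open>{0}\<close>.\<close>
  have "(LINT x:{-B..0} \<union> {0..B}|lborel. ?S x) =
      (LINT x:{-B..0}|lborel. ?S x) + (LINT x:{0..B}|lborel. ?S x)"
    by (intro set_integral_Un_AE survival_integrable X)
      (auto intro!: AE_I'[of "{0}"])
  moreover have "{-B..0} \<union> {0..B} = {-B..B}"
    using \<open>0 \<le> B\<close> by auto
  ultimately show ?thesis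
    unfolding choquet_integral_def 1 2 by simp
qed

lemma choquet_mono_survival:
  assumes "X \<in> acts M" "Y \<in> acts M" "\<And>x. survival M \<mu> Y x \<le> survival M \<mu> X x"
  shows "choquet_integral M \<mu> Y \<le> choquet_integral M \<mu> X"
proof -
  obtain B C where B: "B > 0" "\<And>\<omega>. \<omega> \<in> space M \<Longrightarrow> \<bar>X \<omega>\<bar> \<le> B"
    and C: "C > 0" "\<And>\<omega>. \<omega> \<in> space M \<Longrightarrow> \<bar>Y \<omega>\<bar> \<le> C"
    using assms by (metis actsE)
  define D where "D = max B C"
  have "\<And>\<omega>. \<omega> \<in> space M \<Longrightarrow> \<bar>X \<omega>\<bar> \<le> D" "\<And>\<omega>. \<omega> \<in> space M \<Longrightarrow> \<bar>Y \<omega>\<bar> \<le> D" "D \<ge> 0"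
    using B C unfolding D_def by fastforce+
  then show ?thesis
    using assms choquet_bounded[of X D] choquet_bounded[of Y D]
    by (auto intro!: set_integral_mono survival_integrable acts_measurable)
qed

text \<open>If the integrals agreed, the nonnegative difference of the survival functions would
  vanish almost everywhere, although it is positive on an interval of positive length.\<close>

lemma choquet_strict_mono_survival:
  assumes X: "X \<in> acts M" and Y: "Y \<in> acts M" and le: "\<And>x. survival M \<mu> Y x \<le> survival M \<mu> X x"
    and "q < r" and less: "\<And>x. q < x \<Longrightarrow> x < r \<Longrightarrow> survival M \<mu> Y x < survival M \<mu> X x"
  shows "choquet_integral M \<mu> Y < choquet_integral M \<mu> X"
proof -
  note [measurable] = acts_measurable[OF X] acts_measurable[OF Y]
  note [measurable] = survival_measurable[OF acts_measurable[OF X]] survival_measurable[OF acts_measurable[OF Y]] 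
  obtain B C where B: "B > 0" "\<And>\<omega>. \<omega> \<in> space M \<Longrightarrow> \<bar>X \<omega>\<bar> \<le> B"
    and C: "C > 0" "\<And>\<omega>. \<omega> \<in> space M \<Longrightarrow> \<bar>Y \<omega>\<bar> \<le> C"
    using assms by (metis actsE)
  \<comment> \<open>Including \<open>q\<close> and \<open>r\<close> places the interval of strict
    inequality inside the range of integration.\<close>
  define D where "D = max (max B C) (max \<bar>q\<bar> \<bar>r\<bar>)"
  have D: "\<And>\<omega>. \<omega> \<in> space M \<Longrightarrow> \<bar>X \<omega>\<bar> \<le> D" "\<And>\<omega>. \<omega> \<in> space M \<Longrightarrow> \<bar>Y \<omega>\<bar> \<le> D" "D \<ge> 0" "- D \<le> q" "r \<le> D"
    using B C unfolding D_def by fastforce+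
  let ?h = "\<lambda>x. survival M \<mu> X x - survival M \<mu> Y x"
  have int: "set_integrable lborel {-D..D} ?h"
    by (intro set_integral_diff survival_integrable acts_measurable X Y)
  have "(LINT x:{-D..D}|lborel. ?h x) \<noteq> 0"
  proof
    assume "(LINT x:{-D..D}|lborel. ?h x) = 0"
    then have "AE x in lborel. indicator {-D..D} x *\<^sub>R ?h x = 0"
      using int le unfolding set_lebesgue_integral_def set_integrable_def
      by (subst (asm) integral_nonneg_eq_0_iff_AE) auto
    then have "AE x in lborel. x \<notin> {q<..<r}"
    proof eventually_elim
      case (elim x)
      then show ?case
        using less[of x] D(4,5) by (auto simp: indicator_def split: if_splits)
    qed
    then have "emeasure lborel {q<..<r} = 0"
      by (subst (asm) AE_iff_measurable[of "{q<..<r}"]) auto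
    then show False
      using \<open>q < r\<close> by simp
  qed
  moreover have "(LINT x:{-D..D}|lborel. ?h x) \<ge> 0"
    unfolding set_lebesgue_integral_def using le by (intro integral_nonneg_AE) auto
  moreover have "(LINT x:{-D..D}|lborel. ?h x) =
      (LINT x:{-D..D}|lborel. survival M \<mu> X x) - (LINT x:{-D..D}|lborel. survival M \<mu> Y x)"
    by (intro set_integral_diff survival_integrable acts_measurable X Y)
  ultimately show ?thesis
    using choquet_bounded[OF _ D(1,3)] choquet_bounded[OF _ D(2,3)] by (simp add: X Y acts_measurable)
qed

lemma choquet_mono:
  assumes "X \<in> acts M" "Y \<in> acts M" "\<And>\<omega>. \<omega> \<in> space M \<Longrightarrow> Y \<omega> \<le> X \<omega>"
  shows "choquet_integral M \<mu> Y \<le> choquet_integral M \<mu> X"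
proof (rule choquet_mono_survival[OF assms(1,2)])
  note [measurable] = assms(1,2)
  show "survival M \<mu> Y x \<le> survival M \<mu> X x" for x
    using assms(3) by (intro capacity_mono[OF cap]) (force intro: order.strict_trans2)+
qed

lemma choquet_indicator:
  assumes "A \<in> sets M"
  shows "choquet_integral M \<mu> (indicator A) = \<mu> A"
proof -
  let ?S = "survival M \<mu> (indicator A)"
  \<comment> \<open>The upper level sets are \<open>space M\<close> for \<open>x < 0\<close>,
    \<open>A\<close> for \<open>0 \<le> x < 1\<close> and empty from 1 on; the half-open intervals
    make the two integrands equal at every point.\<close>
  have "(LINT x:{-1..1}|lborel. ?S x) = (\<integral>x. indicator {-1..<0::real} x + \<mu> A * indicator {0..<1} x \<partial>lborel)"
    unfolding set_lebesgue_integral_def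
  proof (rule Bochner_Integration.integral_cong[OF refl])
    fix x :: real
    have "{\<omega> \<in> space M. indicator A \<omega> > x} = A" if "0 \<le> x" "x < 1"
      using that sets.sets_into_space[OF assms] by (auto simp: indicator_def split: if_splits)
    moreover have "?S x = 1" if "x < 0"
      using that by (intro survival_below) (auto simp: indicator_def)
    moreover have "?S x = 0" if "1 \<le> x"
      using that by (intro survival_above) (auto simp: indicator_def)
    ultimately show "indicator {-1..1} x *\<^sub>R ?S x = indicator {-1..<0} x + \<mu> A * indicator {0..<1} x"
      by (cases "x < 0"; cases "x < 1") (auto simp: indicator_def)
  qed
  also have "\<dots> = 1 + \<mu> A"
    by simp
  finally show ?thesis
    using assms by (subst choquet_bounded[of _ 1]) (auto simp: indicator_def)
qed

lemma choquet_const: "choquet_integral M \<mu> (\<lambda>_. c) = c"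
proof -
  let ?S = "survival M \<mu> (\<lambda>_. c)"
  have "(LINT x:{-\<bar>c\<bar>..\<bar>c\<bar>}|lborel. ?S x) = (\<integral>x. indicator {-\<bar>c\<bar>..<c} x \<partial>lborel)"
    unfolding set_lebesgue_integral_def
  proof (rule Bochner_Integration.integral_cong[OF refl])
    fix x :: real
    have "?S x = 1" if "x < c"
      using that by (intro survival_below) auto
    moreover have "?S x = 0" if "c \<le> x"
      using that by (intro survival_above) auto
    ultimately show "indicator {-\<bar>c\<bar>..\<bar>c\<bar>} x *\<^sub>R ?S x = indicator {-\<bar>c\<bar>..<c} x"
      by (cases "x < c") (auto simp: indicator_def)
  qed
  also have "\<dots> = c + \<bar>c\<bar>"
    by simp
  finally show ?thesis
    by (subst choquet_bounded[of _ "\<bar>c\<bar>"]) auto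
qed

end

section \<open>Continuity and comonotonic additivity of the Choquet integral\<close>

lemma continuous_capacity_incseq:
  assumes "continuous_capacity M \<mu>" "\<And>n::nat. A n \<in> sets M" "incseq A"
  shows "(\<lambda>n. \<mu> (A n)) \<longlonglongrightarrow> \<mu> (\<Union>n. A n)"
  using assms unfolding continuous_capacity_def by blast

lemma continuous_capacity_decseq:
  assumes "continuous_capacity M \<mu>" "\<And>n::nat. A n \<in> sets M" "decseq A"
  shows "(\<lambda>n. \<mu> (A n)) \<longlonglongrightarrow> \<mu> (\<Inter>n. A n)"
  using assms unfolding continuous_capacity_def by blast

lemma continuous_capacity_capacity: "continuous_capacity M \<mu> \<Longrightarrow> capacity M \<mu>"
  unfolding continuous_capacity_def by simp

context
  fixes M :: "'a measure" and \<mu> :: "'a set \<Rightarrow> real"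
  assumes cc: "continuous_capacity M \<mu>"
begin

text \<open>The survival values are squeezed between the capacities of a tail intersection and a
  tail union. Their limits are the capacities of the liminf and limsup events, which lie between
  \<open>{X > x}\<close> and \<open>{X \<ge> x}\<close>; continuity in the level closes the
  gap.\<close>

lemma survival_tendsto:
  assumes [measurable]: "\<And>n::nat. Xs n \<in> borel_measurable M" "X \<in> borel_measurable M"
    and lim: "\<And>\<omega>. \<omega> \<in> space M \<Longrightarrow> (\<lambda>n. Xs n \<omega>) \<longlonglongrightarrow> X \<omega>"
    and cont: "isCont (survival M \<mu> X) x"
  shows "(\<lambda>n. survival M \<mu> (Xs n) x) \<longlonglongrightarrow> survival M \<mu> X x"
proof -
  note cap = continuous_capacity_capacity[OF cc]
  define B where "B n = {\<omega>\<in>space M. \<forall>k\<ge>n. Xs k \<omega> > x}" for n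
  define C where "C n = {\<omega>\<in>space M. \<exists>k\<ge>n. Xs k \<omega> > x}" for n
  have [measurable]: "B n \<in> sets M" "C n \<in> sets M" for n
    unfolding B_def C_def by measurable
  have B: "(\<lambda>n. \<mu> (B n)) \<longlonglongrightarrow> \<mu> (\<Union>n. B n)"
    by (rule continuous_capacity_incseq[OF cc]) (auto simp: incseq_def B_def)
  have C: "(\<lambda>n. \<mu> (C n)) \<longlonglongrightarrow> \<mu> (\<Inter>n. C n)"
    by (rule continuous_capacity_decseq[OF cc]) (auto simp: decseq_def C_def intro: order.trans)
  have BX: "\<mu> (B n) \<le> survival M \<mu> (Xs n) x" for n
    by (rule capacity_mono[OF cap]) (auto simp: B_def)
  have XC: "survival M \<mu> (Xs n) x \<le> \<mu> (C n)" for n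
    by (rule capacity_mono[OF cap]) (auto simp: C_def)
  have lower: "survival M \<mu> X x \<le> \<mu> (\<Union>n. B n)"
  proof (rule capacity_mono[OF cap])
    show "{\<omega> \<in> space M. x < X \<omega>} \<subseteq> (\<Union>n. B n)"
    proof
      fix \<omega> assume "\<omega> \<in> {\<omega> \<in> space M. x < X \<omega>}"
      then have "\<omega> \<in> space M" "\<forall>\<^sub>F n in sequentially. x < Xs n \<omega>"
        using order_tendstoD(1)[OF lim] by auto
      then show "\<omega> \<in> (\<Union>n. B n)"
        unfolding B_def eventually_sequentially by blast
    qed
  qed auto
  \<comment> \<open>The limsup event only forces \<open>X \<omega> \<ge> x\<close>, so it is
    compared with the strict level sets at smaller \<open>y\<close>, and then \<open>y\<close> tends
    to \<open>x\<close> from the left.\<close>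
  have "\<mu> (\<Inter>n. C n) \<le> survival M \<mu> X y" if "y < x" for y
  proof (rule capacity_mono[OF cap])
    show "(\<Inter>n. C n) \<subseteq> {\<omega> \<in> space M. y < X \<omega>}"
    proof
      fix \<omega> assume \<omega>: "\<omega> \<in> (\<Inter>n. C n)"
      then have "\<omega> \<in> space M" by (auto simp: C_def)
      moreover have "x \<le> X \<omega>"
      proof (rule ccontr)
        assume "\<not> x \<le> X \<omega>"
        then obtain n where "\<forall>k\<ge>n. Xs k \<omega> < x"
          using order_tendstoD(2)[OF lim[OF \<open>\<omega> \<in> space M\<close>]] by (metis eventually_sequentially not_le)
        moreover obtain k where "k \<ge> n" "Xs k \<omega> > x"
          using \<omega> by (auto simp: C_def)
        ultimately show False by force
      qed
      ultimately show "\<omega> \<in> {\<omega> \<in> space M. y < X \<omega>}" using that by simp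
    qed
  qed auto
  moreover have "(survival M \<mu> X \<longlongrightarrow> survival M \<mu> X x) (at_left x)"
    using cont by (auto simp: isCont_def intro: filterlim_at_split[THEN iffD1, THEN conjunct1])
  ultimately have upper: "\<mu> (\<Inter>n. C n) \<le> survival M \<mu> X x"
    by (intro tendsto_lowerbound[where F = "at_left x"])
      (auto simp: eventually_at_left_field intro!: exI[of _ "x - 1"])
  have "\<mu> (\<Union>n. B n) \<le> \<mu> (\<Inter>n. C n)"
    using B C BX XC by (intro LIMSEQ_le[OF B C]) (meson order.trans)
  then have "\<mu> (\<Union>n. B n) = survival M \<mu> X x" "\<mu> (\<Inter>n. C n) = survival M \<mu> X x"
    using lower upper by linarith+
  then have "(\<lambda>n. \<mu> (B n)) \<longlonglongrightarrow> survival M \<mu> X x" "(\<lambda>n. \<mu> (C n)) \<longlonglongrightarrow> survival M \<mu> X x"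
    using B C by simp_all
  then show ?thesis
    using BX XC by (rule_tac tendsto_sandwich[of "\<lambda>n. \<mu> (B n)" _ _ "\<lambda>n. \<mu> (C n)"]) auto
qed

lemma choquet_tendsto:
  assumes [measurable]: "\<And>n::nat. Xs n \<in> borel_measurable M" "X \<in> borel_measurable M"
    and B: "\<And>n \<omega>. \<omega> \<in> space M \<Longrightarrow> \<bar>Xs n \<omega>\<bar> \<le> B"
    and lim: "\<And>\<omega>. \<omega> \<in> space M \<Longrightarrow> (\<lambda>n. Xs n \<omega>) \<longlonglongrightarrow> X \<omega>"
  shows "(\<lambda>n. choquet_integral M \<mu> (Xs n)) \<longlonglongrightarrow> choquet_integral M \<mu> X"
proof -
  note cap = continuous_capacity_capacity[OF cc]
  define D where "D = \<bar>B\<bar>"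
  have D: "\<bar>Xs n \<omega>\<bar> \<le> D" "0 \<le> D" if "\<omega> \<in> space M" for n \<omega>
    using B[OF that, of n] by (auto simp: D_def)
  have DX: "\<bar>X \<omega>\<bar> \<le> D" if "\<omega> \<in> space M" for \<omega>
    by (rule LIMSEQ_le_const2[OF tendsto_rabs[OF lim[OF that]]]) (use D that in auto)
  note [measurable] = survival_measurable[OF cap]
  \<comment> \<open>The sign change makes the survival function increasing, so that it has only
    countably many discontinuities. These form a null set, and dominated convergence
    applies.\<close>
  have "mono (\<lambda>x. - survival M \<mu> X x)"
    by (auto simp: mono_def intro: survival_antimono[OF cap])
  then have "countable {x. \<not> isCont (\<lambda>x. - survival M \<mu> X x) x}"
    by (rule mono_ctble_discont)
  moreover have "isCont (\<lambda>x. - survival M \<mu> X x) x \<longleftrightarrow> isCont (survival M \<mu> X) x" for x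
    using isCont_minus[of x "\<lambda>x. - survival M \<mu> X x"] isCont_minus[of x "survival M \<mu> X"]
    unfolding minus_minus by blast
  ultimately have "countable {x. \<not> isCont (survival M \<mu> X) x}" by simp
  then have "AE x in lborel. x \<notin> {x. \<not> isCont (survival M \<mu> X) x}"
    by (intro AE_not_in countable_imp_null_set_lborel)
  then have ae: "AE x in lborel. (\<lambda>n. indicator {-D..D} x *\<^sub>R survival M \<mu> (Xs n) x) \<longlonglongrightarrow> indicator {-D..D} x *\<^sub>R survival M \<mu> X x"
    by eventually_elim (auto intro!: tendsto_mult survival_tendsto lim)
  have "(\<lambda>n. LINT x:{-D..D}|lborel. survival M \<mu> (Xs n) x) \<longlonglongrightarrow> (LINT x:{-D..D}|lborel. survival M \<mu> X x)"
    unfolding set_lebesgue_integral_def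
  proof (rule integral_dominated_convergence[where w = "indicator {-D..D}"])
    show "AE x in lborel. norm (indicator {-D..D} x *\<^sub>R survival M \<mu> (Xs n) x) \<le> indicator {-D..D} x" for n
      using survival_bounds[OF cap, of "Xs n"] by (auto simp: indicator_def)
  qed (use ae in \<open>auto simp: emeasure_lborel_Icc_eq\<close>)
  then have "(\<lambda>n. (LINT x:{-D..D}|lborel. survival M \<mu> (Xs n) x) - D) \<longlonglongrightarrow> (LINT x:{-D..D}|lborel. survival M \<mu> X x) - D"
    by (intro tendsto_diff) auto
  moreover have "D \<ge> 0" by (simp add: D_def)
  ultimately show ?thesis
    using D DX by (simp add: choquet_bounded[OF cap, of _ D])
qed

end

text \<open>Layer-cake formula: \<open>h y + C\<close> is the length of \<open>[-C, h y)\<close>,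
  and Fubini exchanges integration over points and levels.\<close>

lemma (in prob_space) choquet_integral_prob:
  fixes h :: "'a \<Rightarrow> real"
  assumes [measurable]: "h \<in> borel_measurable M" and C: "\<And>y. y \<in> space M \<Longrightarrow> \<bar>h y\<bar> \<le> C"
  shows "choquet_integral M prob h = expectation h"
proof -
  interpret pair_sigma_finite M lborel ..
  have cap: "capacity M prob"
    by (auto simp: capacity_def prob_space intro: finite_measure_mono)
  obtain y0 where "y0 \<in> space M" using not_empty by auto
  from C[OF this] have "0 \<le> C" by linarith
  let ?f = "\<lambda>y x. indicator {-C..<h y} x :: real"
  have f: "(\<integral>x. ?f y x \<partial>lborel) = h y + C" if "y \<in> space M" for y
    using C[OF that] by simp
  have int_h: "integrable M h"
    using C by (intro integrable_const_bound[where B = C]) auto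
  have int: "integrable (M \<Otimes>\<^sub>M lborel) (\<lambda>(y, x). ?f y x)"
  proof (rule Fubini_integrable)
    have "integrable M (\<lambda>y. h y + C)"
      using int_h by auto
    then show "integrable M (\<lambda>y. \<integral>x. norm (case (y, x) of (y, x) \<Rightarrow> ?f y x) \<partial>lborel)"
      by (rule Bochner_Integration.integrable_cong[OF refl, THEN iffD1, rotated]) (use f in simp)
    show "AE y in M. integrable lborel (\<lambda>x. case (y, x) of (y, x) \<Rightarrow> ?f y x)"
    proof (rule AE_I2)
      fix y assume "y \<in> space M"
      then have "- C \<le> h y" using C[of y] by simp
      then show "integrable lborel (\<lambda>x. case (y, x) of (y, x) \<Rightarrow> ?f y x)" by simp
    qed
  show "(\<lambda>(y, x). ?f y x) \<in> borel_measurable (M \<Otimes>\<^sub>M lborel)"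
    proof -
      have *: "(\<lambda>(y, x). ?f y x) = (\<lambda>p. if - C \<le> snd p \<and> snd p < h (fst p) then 1 else 0)"
        by (auto simp: indicator_def fun_eq_iff)
      show ?thesis unfolding * by measurable
    qed
  qed
  have "(\<integral>y. (\<integral>x. ?f y x \<partial>lborel) \<partial>M) = (\<integral>x. (\<integral>y. ?f y x \<partial>M) \<partial>lborel)"
    using Fubini_integral[OF int] by simp
  also have "(\<integral>y. (\<integral>x. ?f y x \<partial>lborel) \<partial>M) = (\<integral>y. h y + C \<partial>M)"
    using f by (intro Bochner_Integration.integral_cong) auto
  also have "\<dots> = expectation h + C"
    using int_h by (simp add: prob_space)
  also have "(\<integral>x. (\<integral>y. ?f y x \<partial>M) \<partial>lborel) = (LINT x:{-C..C}|lborel. prob {y\<in>space M. h y > x})"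
    unfolding set_lebesgue_integral_def
  proof (rule Bochner_Integration.integral_cong[OF refl])
    fix x :: real
    have sub: "{y\<in>space M. h y > x} \<subseteq> space M" by auto
    have "(\<integral>y. ?f y x \<partial>M) = (\<integral>y. indicator {-C..} x * indicator {y\<in>space M. h y > x} y \<partial>M)"
      by (intro Bochner_Integration.integral_cong) (auto simp: indicator_def)
    also have "\<dots> = indicator {-C..} x * prob {y\<in>space M. h y > x}"
      by (simp add: Int_absorb2[OF sub])
    also have "\<dots> = indicator {-C..C} x *\<^sub>R prob {y\<in>space M. h y > x}"
    \<comment> \<open>Above \<open>C\<close> the upper level set of \<open>h\<close> is empty, which
      allows the half-line to be cut at \<open>C\<close>.\<close>
    proof (cases "x \<le> C")
      case False
      have "prob {y\<in>space M. h y > x} = 0"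
      proof (rule survival_above[OF cap])
        fix y assume "y \<in> space M"
        then show "h y \<le> x" using C[of y] False by linarith
      qed
      then show ?thesis by simp
    qed (auto simp: indicator_def)
    finally show "(\<integral>y. ?f y x \<partial>M) = indicator {-C..C} x *\<^sub>R prob {y\<in>space M. h y > x}" .
  qed
  finally show ?thesis
    using choquet_bounded[OF cap _ C \<open>0 \<le> C\<close>] by simp
qed

text \<open>The set where \<open>u \<le> x\<close> is closed and closed downwards, so it is empty,
  the whole line, or a ray that contains its supremum. Hence upper level sets of \<open>u(W)\<close>
  are trivial or upper level sets of \<open>W\<close>.\<close>

lemma mono_continuous_superlevel_cases:
  fixes u :: "real \<Rightarrow> real"
  assumes "mono u" "continuous_on UNIV u"
  obtains "{y. u y > x} = {}" | "{y. u y > x} = UNIV" | w where "{y. u y > x} = {w<..}"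
proof -
  define A where "A = {y. u y \<le> x}"
  have "closed A"
    unfolding A_def using assms(2) by (intro closed_Collect_le) auto
  have down: "z \<in> A" if "y \<in> A" "z \<le> y" for y z
    using that monoD[OF assms(1)] order.trans unfolding A_def by blast
  consider "A = {}" | "\<not> bdd_above A" | "A \<noteq> {}" "bdd_above A" by blast
  then show thesis
  proof cases
    case 1
    then have "{y. u y > x} = UNIV" by (auto simp: A_def not_le)
    then show thesis using that(2) by blast
  next
    case 2
    then have "A = UNIV"
      using down by (metis UNIV_eq_I bdd_above.unfold nle_le)
    then have "{y. u y > x} = {}" by (auto simp: A_def set_eq_iff not_less)
    then show thesis using that(1) by blast
  next
    case 3
    then have "Sup A \<in> A"
      using \<open>closed A\<close> closed_contains_Sup by blast
    then have "y \<in> A \<longleftrightarrow> y \<le> Sup A" for y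
      using down[of "Sup A" y] 3 cSup_upper[of y A] by blast
    then have "u y > x \<longleftrightarrow> y > Sup A" for y
      unfolding A_def by (metis mem_Collect_eq not_le)
    then have "{y. u y > x} = {Sup A<..}"
      by auto
    then show thesis using that(3) by blast
  qed
qed

section \<open>Laws of acts under a continuous capacity and comonotonic additivity\<close>

context
  fixes M :: "'a measure" and \<mu> :: "'a set \<Rightarrow> real"
  assumes cc: "continuous_capacity M \<mu>"
begin

text \<open>Along the chain of upper level sets of one act, a continuous capacity behaves like a
  probability: \<open>1 - survival\<close> is increasing, and right-continuous because decreasing
  levels give increasing sets. Boundedness of \<open>W\<close> gives the limits 0 and 1.\<close>

lemma survival_law:
  assumes "W \<in> acts M"
  obtains N where "real_distribution N" "\<And>w. measure N {w<..} = survival M \<mu> W w"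
proof -
  note cap = continuous_capacity_capacity[OF cc]
  note [measurable] = acts_measurable[OF assms]
  obtain B where B: "B > 0" "\<And>\<omega>. \<omega> \<in> space M \<Longrightarrow> \<bar>W \<omega>\<bar> \<le> B"
    using assms by (metis actsE)
  define F where "F w = 1 - survival M \<mu> W w" for w
  have mono: "F x \<le> F y" if "x \<le> y" for x y
    using survival_antimono[OF cap _ that, of W] by (simp add: F_def)
  have rc: "continuous (at_right a) F" for a
    unfolding continuous_within
  proof (rule tendsto_at_right_sequentially[of a "a + 1"])
    fix S :: "nat \<Rightarrow> real"
    assume S: "\<And>n. a < S n" "decseq S" "S \<longlonglongrightarrow> a"
    have "(\<lambda>n. survival M \<mu> W (S n)) \<longlonglongrightarrow> \<mu> (\<Union>n. {\<omega>\<in>space M. W \<omega> > S n})"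
      using S(2) by (intro continuous_capacity_incseq[OF cc])
        (auto simp: incseq_def decseq_def intro: le_less_trans)
    also have "(\<Union>n. {\<omega>\<in>space M. W \<omega> > S n}) = {\<omega>\<in>space M. W \<omega> > a}"
    proof (intro set_eqI iffI)
      fix \<omega> assume "\<omega> \<in> {\<omega>\<in>space M. W \<omega> > a}"
      then have "\<omega> \<in> space M" "\<forall>\<^sub>F n in sequentially. S n < W \<omega>"
        using order_tendstoD(2)[OF S(3)] by auto
      then show "\<omega> \<in> (\<Union>n. {\<omega>\<in>space M. W \<omega> > S n})"
        unfolding eventually_sequentially by blast
    qed (use S(1) in \<open>auto intro: less_trans\<close>)
    finally show "(\<lambda>n. F (S n)) \<longlonglongrightarrow> F a"
      unfolding F_def by (intro tendsto_diff) auto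
  qed simp
  have "F x = 0" if "x < - B" for x
    unfolding F_def using survival_below[OF cap, of x W] B(2) that by force
  then have bot: "(F \<longlongrightarrow> 0) at_bot"
    by (intro tendsto_eventually) (auto simp: eventually_at_bot_dense)
  have "F x = 1" if "B < x" for x
    unfolding F_def using survival_above[OF cap, of W x] B(2) that by force
  then have top: "(F \<longlongrightarrow> 1) at_top"
    by (intro tendsto_eventually) (auto simp: eventually_at_top_dense)
  interpret N: real_distribution "interval_measure F"
    by (rule real_distribution_interval_measure[OF mono rc bot top])
  have "measure (interval_measure F) {w<..} = survival M \<mu> W w" for w
  proof -
    have "measure (interval_measure F) {w<..} = 1 - measure (interval_measure F) {..w}"
      using N.prob_compl[of "{..w}"] by (simp add: Compl_eq_Diff_UNIV[symmetric])
    then show ?thesis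
      using measure_interval_measure_Iic[OF mono rc bot] by (simp add: F_def)
  qed
  then show thesis
    using that N.real_distribution_axioms by blast
qed

lemma choquet_comonotonic_add:
  assumes X: "X \<in> acts M" and Z: "Z \<in> acts M" and com: "comonotonic M X Z"
  shows "choquet_integral M \<mu> (\<lambda>\<omega>. X \<omega> + Z \<omega>) = choquet_integral M \<mu> X + choquet_integral M \<mu> Z"
proof -
  note cap = continuous_capacity_capacity[OF cc]
  define W where "W \<omega> = X \<omega> + Z \<omega>" for \<omega>
  have W: "W \<in> acts M"
    unfolding W_def using X Z by (rule add_acts)
  obtain B where B: "B > 0" "\<And>\<omega>. \<omega> \<in> space M \<Longrightarrow> \<bar>W \<omega>\<bar> \<le> B"
    using W by (metis actsE)
  obtain C where C: "C > 0" "\<And>\<omega>. \<omega> \<in> space M \<Longrightarrow> \<bar>X \<omega>\<bar> \<le> C"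
    using X by (metis actsE)
  have ne: "space M \<noteq> {}"
    using cap by (auto simp: capacity_def)
  text \<open>\<open>X\<close> is a function of \<open>W\<close> that is increasing and 1-Lipschitz on the range of \<open>W\<close>;
    its McShane extension \<open>u0\<close> to the reals inherits both properties.\<close>
  define u0 where "u0 w = (INF \<omega>\<in>space M. X \<omega> + max 0 (w - W \<omega>))" for w
  have bdd: "bdd_below ((\<lambda>\<omega>. X \<omega> + max 0 (w - W \<omega>)) ` space M)" for w
    using C(2) by (intro bdd_belowI2[of _ "- C"]) force
  have u0_W: "u0 (W \<omega>) = X \<omega>" if "\<omega> \<in> space M" for \<omega>
  proof (rule antisym)
    show "u0 (W \<omega>) \<le> X \<omega>"
      unfolding u0_def using cINF_lower[OF bdd that, of "W \<omega>"] by simp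
    show "X \<omega> \<le> u0 (W \<omega>)"
      unfolding u0_def
    proof (rule cINF_greatest[OF ne])
      fix \<omega>' assume "\<omega>' \<in> space M"
      then have "(X \<omega> - X \<omega>') * (Z \<omega> - Z \<omega>') \<ge> 0"
        using com that by (auto simp: comonotonic_def)
      \<comment> \<open>If both acts are at least as large at \<open>\<omega>\<close> as at
        \<open>\<omega>'\<close>, the increase of \<open>W\<close> is at least that of
        \<open>X\<close>. If \<open>X\<close> does not increase, the bound is immediate, and if
        \<open>Z\<close> does not change, \<open>W\<close> increases exactly as \<open>X\<close>
        does.\<close>
      then have "X \<omega> \<le> X \<omega>' \<and> Z \<omega> \<le> Z \<omega>' \<or> X \<omega> \<ge> X \<omega>' \<and> Z \<omega> \<ge> Z \<omega>' \<or> X \<omega> = X \<omega>' \<or> Z \<omega> = Z \<omega>'"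
        by (auto simp: zero_le_mult_iff)
      then show "X \<omega> \<le> X \<omega>' + max 0 (W \<omega> - W \<omega>')"
        unfolding W_def by auto
    qed
  qed
  have u0_mono: "u0 v \<le> u0 w" if "v \<le> w" for v w
    unfolding u0_def using that by (intro cINF_mono[OF ne bdd], rule_tac x = m in bexI) auto
  have u0_lip: "u0 w \<le> u0 v + (w - v)" if "v \<le> w" for v w
  proof -
    have "u0 w - (w - v) \<le> u0 v"
      unfolding u0_def[of v]
    proof (rule cINF_greatest[OF ne])
      fix \<omega> assume "\<omega> \<in> space M"
      then have "u0 w \<le> X \<omega> + max 0 (w - W \<omega>)"
        unfolding u0_def by (intro cINF_lower bdd)
      then show "u0 w - (w - v) \<le> X \<omega> + max 0 (v - W \<omega>)"
        using that by auto
    qed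
    then show ?thesis by simp
  qed
  have u0_cont: "continuous_on UNIV u0"
    unfolding continuous_on_iff
  proof (intro ballI allI impI)
    fix x e :: real assume "0 < e"
    moreover have "dist (u0 y) (u0 x) \<le> dist y x" for y
      using u0_mono[of x y] u0_mono[of y x] u0_lip[of x y] u0_lip[of y x] 
      by (cases x y rule: le_cases) (auto simp: dist_real_def)
    ultimately show "\<exists>d>0. \<forall>x'\<in>UNIV. dist x' x < d \<longrightarrow> dist (u0 x') (u0 x) < e"
      by (metis le_less_trans)
  qed
  \<comment> \<open>Clamping to \<open>[-B, B]\<close> changes nothing on the range of
    \<open>W\<close>, but makes \<open>u\<close> and \<open>v\<close> bounded and thus integrable
    under the law of \<open>W\<close>.\<close>
  define k where "k w = max (-B) (min B w)" for w :: real
  have k_cont: "continuous_on UNIV k"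
    unfolding k_def by (intro continuous_intros)
  have k_W: "k (W \<omega>) = W \<omega>" if "\<omega> \<in> space M" for \<omega>
    using B(2)[OF that] by (auto simp: k_def)
  have k_mono: "k v \<le> k w" if "v \<le> w" for v w
    using that by (auto simp: k_def)
  have k_bound: "- B \<le> k w" "k w \<le> B" for w
    using \<open>B > 0\<close> by (auto simp: k_def)
  define u where "u w = u0 (k w)" for w
  define v where "v w = k w - u0 (k w)" for w
  have mono: "mono u" "mono v" "mono k"
  proof -
    show "mono u" "mono k"
      unfolding u_def mono_def using u0_mono k_mono by auto
    \<comment> \<open>The Lipschitz constant 1 is what makes the remainder \<open>k - u\<close>
      increasing.\<close>
    show "mono v"
      unfolding v_def
    proof (rule monoI)
      fix x y :: real assume "x \<le> y"
      from u0_lip[OF k_mono[OF this]] show "k x - u0 (k x) \<le> k y - u0 (k y)" by linarith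
    qed
  qed
  have cont: "continuous_on UNIV u" "continuous_on UNIV v"
    unfolding u_def v_def using k_cont continuous_on_compose2[OF u0_cont k_cont]
    by (auto intro: continuous_on_diff)
  \<comment> \<open>By monotonicity, \<open>u0\<close> takes its extreme values over
    \<open>[-B, B]\<close> at the endpoints.\<close>
  define D where "D = max \<bar>u0 B\<bar> \<bar>u0 (-B)\<bar>"
  have bound_u: "\<bar>u w\<bar> \<le> D" for w
    using u0_mono[OF k_bound(1)[of w]] u0_mono[OF k_bound(2)[of w]] unfolding u_def D_def by linarith
  have bound_k: "\<bar>k w\<bar> \<le> B" for w
    using k_bound[of w] by linarith
  have bound_v: "\<bar>v w\<bar> \<le> B + D" for w
    using bound_u[of w] bound_k[of w] unfolding u_def v_def by linarith
  note bound = bound_u bound_v bound_k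

  obtain N where "real_distribution N" and N: "\<And>w. measure N {w<..} = survival M \<mu> W w"
    using survival_law[OF W] by blast
  interpret N: real_distribution N by fact
  \<comment> \<open>Every upper level set of \<open>f\<close> is empty, full or an open ray, and on
    each of these the capacity seen through \<open>W\<close> agrees with \<open>N\<close>. The
    integral thereby becomes an expectation, which is linear.\<close>
  have transfer: "choquet_integral M \<mu> (\<lambda>\<omega>. f (W \<omega>)) = N.expectation f"
    if f: "mono f" "continuous_on UNIV f" "\<And>w. \<bar>f w\<bar> \<le> D" for f D
  proof -
    have "survival M \<mu> (\<lambda>\<omega>. f (W \<omega>)) x = survival N (measure N) f x" for x
    proof (cases x rule: mono_continuous_superlevel_cases[OF f(1,2)])
      case 1
      then have *: "{\<omega> \<in> space M. f (W \<omega>) > x} = {}" "{w \<in> space N. f w > x} = {}" by auto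
      show ?thesis unfolding * using cap by (simp add: capacity_def)
    next
      case 2
      then have *: "{\<omega> \<in> space M. f (W \<omega>) > x} = space M" "{w \<in> space N. f w > x} = space N" by auto
      show ?thesis unfolding * using cap N.prob_space by (simp add: capacity_def)
    next
      case (3 w)
      then have *: "{\<omega> \<in> space M. f (W \<omega>) > x} = {\<omega> \<in> space M. W \<omega> > w}" "{w \<in> space N. f w > x} = {w<..}"
        by (auto simp: set_eq_iff)
      show ?thesis unfolding * using N by simp
    qed
    then have "choquet_integral M \<mu> (\<lambda>\<omega>. f (W \<omega>)) = choquet_integral N (measure N) f"
      unfolding choquet_integral_def by simp
    also have "\<dots> = N.expectation f"
      using f(3) borel_measurable_mono[OF f(1)] by (intro N.choquet_integral_prob) auto
    finally show ?thesis .
  qed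
  \<comment> \<open>The identities relating \<open>k\<close>, \<open>u\<close> and \<open>v\<close>
    to the acts are available only on \<open>space M\<close>, which is all that the integral
    sees.\<close>
  have cong: "choquet_integral M \<mu> f = choquet_integral M \<mu> g" if "\<And>\<omega>. \<omega> \<in> space M \<Longrightarrow> f \<omega> = g \<omega>" for f g
  proof -
    have "{\<omega> \<in> space M. f \<omega> > x} = {\<omega> \<in> space M. g \<omega> > x}" for x
      using that by auto
    then show ?thesis by (simp add: choquet_integral_def)
  qed
  have "choquet_integral M \<mu> (\<lambda>\<omega>. X \<omega> + Z \<omega>) = choquet_integral M \<mu> (\<lambda>\<omega>. k (W \<omega>))"
    by (rule cong) (simp add: k_W, simp add: W_def)
  also have "\<dots> = N.expectation (\<lambda>w. u w + v w)"
    using transfer[OF mono(3) k_cont bound(3)] by (simp add: u_def v_def)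
  also have "\<dots> = N.expectation u + N.expectation v"
    using bound mono(1,2)[THEN borel_measurable_mono]
    by (intro Bochner_Integration.integral_add; intro N.integrable_const_bound) auto
  also have "N.expectation u = choquet_integral M \<mu> (\<lambda>\<omega>. u (W \<omega>))"
    using transfer[OF mono(1) cont(1) bound(1)] by simp
  also have "\<dots> = choquet_integral M \<mu> X"
    by (rule cong) (simp add: u_def k_W u0_W)
  also have "N.expectation v = choquet_integral M \<mu> (\<lambda>\<omega>. v (W \<omega>))"
    using transfer[OF mono(2) cont(2) bound(2)] by simp
  also have "\<dots> = choquet_integral M \<mu> Z"
    by (rule cong) (simp add: v_def k_W u0_W, simp add: W_def)
  finally show ?thesis .
qed

end

section \<open>Choquet representations satisfy the axioms\<close>

lemma comonotonic_scale:
  assumes "comonotonic M X Z" "0 \<le> a" "0 \<le> b"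
  shows "comonotonic M (\<lambda>\<omega>. a * X \<omega>) (\<lambda>\<omega>. b * Z \<omega>)"
  unfolding comonotonic_def
proof (intro ballI)
  fix \<omega> \<omega>' assume "\<omega> \<in> space M" "\<omega>' \<in> space M"
  then have "0 \<le> (a * b) * ((X \<omega> - X \<omega>') * (Z \<omega> - Z \<omega>'))"
    using assms unfolding comonotonic_def by (meson mult_nonneg_nonneg)
  then show "0 \<le> (a * X \<omega> - a * X \<omega>') * (b * Z \<omega> - b * Z \<omega>')"
    by (simp add: algebra_simps)
qed

lemma choquet_half_sum:
  assumes cc: "continuous_capacity M \<mu>" and X: "X \<in> acts M" and Z: "Z \<in> acts M" and com: "comonotonic M X Z"
  shows "choquet_integral M \<mu> (\<lambda>\<omega>. (1/2) * X \<omega> + (1/2) * Z \<omega>) =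
    (choquet_integral M \<mu> X + choquet_integral M \<mu> Z) / 2"
proof -
  \<comment> \<open>Half of \<open>Y\<close> is comonotonic with itself, so additivity alone yields
    homogeneity for the factor 1/2.\<close>
  have half: "2 * choquet_integral M \<mu> (\<lambda>\<omega>. (1/2) * Y \<omega>) = choquet_integral M \<mu> Y" if "Y \<in> acts M" for Y
  proof -
    have "comonotonic M (\<lambda>\<omega>. (1/2) * Y \<omega>) (\<lambda>\<omega>. (1/2) * Y \<omega>)"
      by (intro comonotonic_scale) (auto simp: comonotonic_def)
    then show ?thesis
      using choquet_comonotonic_add[OF cc scale_acts[OF that, of "1/2"] scale_acts[OF that, of "1/2"]]
      by simp
  qed
  have *: "choquet_integral M \<mu> (\<lambda>\<omega>. (1/2) * X \<omega> + (1/2) * Z \<omega>) =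
    choquet_integral M \<mu> (\<lambda>\<omega>. (1/2) * X \<omega>) + choquet_integral M \<mu> (\<lambda>\<omega>. (1/2) * Z \<omega>)"
    by (intro choquet_comonotonic_add[OF cc] comonotonic_scale scale_acts X Z com) auto
  show ?thesis
    unfolding * half[OF X, symmetric] half[OF Z, symmetric] by simp
qed

text \<open>Serves in both directions: for \<open>g \<circ> \<nu>\<close> when a representation is
  given, and for the inverse distortion applied to \<open>\<mu>\<close> when one is
  constructed.\<close>

lemma distorted_continuous_capacity:
  assumes g: "distortion_function g" "continuous_on {0..1} g" and \<nu>: "continuous_capacity M \<nu>"
  shows "continuous_capacity M (g \<circ> \<nu>)"
proof -
  note cap = continuous_capacity_capacity[OF \<nu>]
  have bounds: "\<nu> A \<in> {0..1}" if "A \<in> sets M" for A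
    using capacity_bounds[OF cap that] by auto
  have "g (\<nu> A) \<le> g (\<nu> B)" if "A \<in> sets M" "B \<in> sets M" "A \<subseteq> B" for A B
    using g(1) bounds that capacity_mono[OF cap that] by (auto simp: distortion_function_def mono_on_def)
  then have "capacity M (g \<circ> \<nu>)"
    using g(1) cap by (simp add: capacity_def distortion_function_def)
  moreover have "(\<lambda>n. g (\<nu> (A n))) \<longlonglongrightarrow> g (\<nu> B)"
    if "(\<lambda>n. \<nu> (A n)) \<longlonglongrightarrow> \<nu> B" "\<And>n. A n \<in> sets M" "B \<in> sets M" for A :: "nat \<Rightarrow> _" and B
    using that bounds by (intro continuous_on_tendsto_compose[OF g(2)]) auto
  ultimately show ?thesis
    unfolding continuous_capacity_def
    using continuous_capacity_incseq[OF \<nu>] continuous_capacity_decseq[OF \<nu>]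
    by (simp add: range_subsetD sets.countable_UN sets.countable_INT)
qed

lemma subalgebra_acts:
  assumes "subalgebra M P" "X \<in> acts P"
  shows "X \<in> acts M"
  using assms measurable_from_subalg[OF assms(1)] unfolding acts_def subalgebra_def by auto

text \<open>The event \<open>X > Y\<close> is covered by the countably many events
  \<open>Y \<le> q\<close>, \<open>r < X\<close> with rational \<open>q < r\<close>, so one of these
  has positive probability. It separates the two tails at every level between \<open>q\<close> and
  \<open>r\<close>.\<close>

lemma (in prob_space) strict_gap:
  fixes X Y :: "'a \<Rightarrow> real"
  assumes [measurable]: "X \<in> borel_measurable M" "Y \<in> borel_measurable M"
    and ge: "prob {\<omega>\<in>space M. X \<omega> \<ge> Y \<omega>} = 1" and gt: "prob {\<omega>\<in>space M. X \<omega> > Y \<omega>} > 0"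
  obtains q r where "q < r"
    "\<And>x. q < x \<Longrightarrow> x < r \<Longrightarrow> prob {\<omega>\<in>space M. Y \<omega> > x} < prob {\<omega>\<in>space M. X \<omega> > x}"
proof -
  let ?E = "\<lambda>q r. {\<omega>\<in>space M. X \<omega> > r \<and> Y \<omega> \<le> q}"
  have ae: "AE \<omega> in M. X \<omega> \<ge> Y \<omega>"
    using ge by (subst (asm) prob_Collect_eq_1) auto
  have "\<exists>q r. q < r \<and> prob (?E q r) \<noteq> 0"
  proof (rule ccontr)
    assume "\<not> ?thesis"
    then have "AE \<omega> in M. \<not> (X \<omega> > r \<and> Y \<omega> \<le> q)" if "q < r" for q r
      using that by (intro prob_Collect_eq_0[THEN iffD1]) auto
    then have "AE \<omega> in M. \<forall>p\<in>\<rat>\<times>\<rat>. fst p < snd p \<longrightarrow> \<not> (X \<omega> > snd p \<and> Y \<omega> \<le> fst p)"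
      using countable_rat by (subst AE_ball_countable) (blast, fastforce)
    then have "AE \<omega> in M. \<not> X \<omega> > Y \<omega>"
    proof eventually_elim
      case (elim \<omega>)
      show ?case
      proof
        assume "Y \<omega> < X \<omega>"
        from Rats_dense_in_real[OF this] obtain r where "r \<in> \<rat>" "Y \<omega> < r" "r < X \<omega>" by blast
        moreover from Rats_dense_in_real[OF this(2)] obtain q where "q \<in> \<rat>" "Y \<omega> < q" "q < r" by blast
        ultimately show False using bspec[OF elim, of "(q, r)"] by simp
      qed
    qed
    then have "prob {\<omega>\<in>space M. X \<omega> > Y \<omega>} = 0"
      by (subst prob_Collect_eq_0) auto
    with gt show False by simp
  qed
  then obtain q r where "q < r" "prob (?E q r) \<noteq> 0"
    by (elim exE conjE)
  then have qr: "q < r" "prob (?E q r) > 0"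
    unfolding zero_less_measure_iff .
  show thesis
  proof (rule that[OF qr(1)])
    fix x assume x: "q < x" "x < r"
    \<comment> \<open>Up to a null set \<open>Y > x\<close> entails \<open>X > x\<close>. The event
      \<open>?E q r\<close> is disjoint from it, since there \<open>Y \<le> q < x\<close>, and also
      lies inside \<open>X > x\<close>, so it adds its positive probability.\<close>
    have "prob {\<omega>\<in>space M. Y \<omega> > x} = prob {\<omega>\<in>space M. Y \<omega> > x \<and> X \<omega> \<ge> Y \<omega>}"
    proof (rule finite_measure_eq_AE)
      show "AE \<omega> in M. (\<omega> \<in> {\<omega>\<in>space M. Y \<omega> > x}) = (\<omega> \<in> {\<omega>\<in>space M. Y \<omega> > x \<and> X \<omega> \<ge> Y \<omega>})"
        using ae by eventually_elim simp
    qed measurable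
    also have "\<dots> < prob {\<omega>\<in>space M. Y \<omega> > x \<and> X \<omega> \<ge> Y \<omega>} + prob (?E q r)"
      using qr by simp
    also have "\<dots> = prob ({\<omega>\<in>space M. Y \<omega> > x \<and> X \<omega> \<ge> Y \<omega>} \<union> ?E q r)"
    proof (rule finite_measure_Union[symmetric])
      show "{\<omega>\<in>space M. Y \<omega> > x \<and> X \<omega> \<ge> Y \<omega>} \<inter> ?E q r = {}"
        using x by auto
    qed measurable
    also have "\<dots> \<le> prob {\<omega>\<in>space M. X \<omega> > x}"
    proof (rule finite_measure_mono)
      show "{\<omega>\<in>space M. Y \<omega> > x \<and> X \<omega> \<ge> Y \<omega>} \<union> ?E q r \<subseteq> {\<omega>\<in>space M. X \<omega> > x}"
        using x by auto
    qed measurable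
    finally show "prob {\<omega>\<in>space M. Y \<omega> > x} < prob {\<omega>\<in>space M. X \<omega> > x}" .
  qed
qed

lemma atomless_obtain:
  assumes "atomless P" "A \<in> sets P" "0 \<le> t" "t \<le> measure P A"
  obtains B where "B \<in> sets P" "B \<subseteq> A" "measure P B = t"
proof -
  have "{measure P B | B. B \<in> sets P \<and> B \<subseteq> A} = {0..measure P A}"
    using assms(1,2) unfolding atomless_def by (rule bspec)
  moreover have "t \<in> {0..measure P A}"
    using assms(3,4) by simp
  ultimately have "t \<in> {measure P B | B. B \<in> sets P \<and> B \<subseteq> A}"
    by (simp only:)
  then show thesis using that by auto
qed

section \<open>From a representation to the axioms, the matching probability and uniqueness\<close>

context
  fixes M P :: "'a measure" and pref :: "'a pref" and g \<nu>
  assumes P: "prob_space P" and sub: "subalgebra M P" and rep: "choquet_representation M P pref g \<nu>"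
begin

interpretation prob_space P by (rule P)

lemma representation_capacity: "continuous_capacity M (g \<circ> \<nu>)"
  using rep by (auto simp: choquet_representation_def intro: distorted_continuous_capacity)

lemma representation_pref:
  "X \<in> acts M \<Longrightarrow> Y \<in> acts M \<Longrightarrow>
    pref X Y \<longleftrightarrow> choquet_integral M (g \<circ> \<nu>) X \<ge> choquet_integral M (g \<circ> \<nu>) Y"
  using rep by (simp add: choquet_representation_def)

lemma representation_indifferent:
  "X \<in> acts M \<Longrightarrow> Y \<in> acts M \<Longrightarrow>
    indifferent pref X Y \<longleftrightarrow> choquet_integral M (g \<circ> \<nu>) X = choquet_integral M (g \<circ> \<nu>) Y"
  unfolding indifferent_def by (auto simp: representation_pref)

lemma representation_strict_mono:
  "strict_mono_on {0..1} g" "g 0 = 0" "g 1 = 1"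
  using rep by (auto simp: choquet_representation_def distortion_function_def)

text \<open>Risk conformity turns the distorted capacity into \<open>g\<close> of a tail
  probability, which reduces (RC) and (SRM) to statements about tails.\<close>

lemma representation_survival:
  assumes "X \<in> acts P"
  shows "survival M (g \<circ> \<nu>) X x = g (prob {\<omega>\<in>space P. X \<omega> > x})"
  using rep sub sets_greater[OF acts_measurable[OF assms], of x]
  by (auto simp: choquet_representation_def risk_conforming_def subalgebra_def)

lemma representation_RC: "axiom_RC P pref"
  unfolding axiom_RC_def
proof (intro ballI impI)
  fix X Y assume X: "X \<in> acts P" and Y: "Y \<in> acts P"
    and "\<forall>x. prob {\<omega>\<in>space P. X \<omega> > x} = prob {\<omega>\<in>space P. Y \<omega> > x}"
  then have "survival M (g \<circ> \<nu>) X = survival M (g \<circ> \<nu>) Y"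
    by (simp only: representation_survival)
  then show "indifferent pref X Y"
    using X Y by (simp add: representation_indifferent subalgebra_acts[OF sub] choquet_integral_def fun_eq_iff)
qed

lemma representation_M: "axiom_M M pref"
  unfolding axiom_M_def
  by (simp add: representation_pref choquet_mono[OF continuous_capacity_capacity[OF representation_capacity]])

text \<open>Almost sure dominance orders all tails, and \<open>strict_gap\<close> provides an
  interval of levels where they differ. Strict monotonicity of \<open>g\<close> carries both facts
  to the survival functions.\<close>

lemma representation_SRM: "axiom_SRM P pref"
  unfolding axiom_SRM_def
proof (intro ballI impI, elim conjE)
  fix X Y assume X: "X \<in> acts P" and Y: "Y \<in> acts P"
    and ge: "prob {\<omega>\<in>space P. X \<omega> \<ge> Y \<omega>} = 1" and gt: "prob {\<omega>\<in>space P. X \<omega> > Y \<omega>} > 0"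
  note [measurable] = X Y
  obtain q r where qr: "q < r"
    "\<And>x. q < x \<Longrightarrow> x < r \<Longrightarrow> prob {\<omega>\<in>space P. Y \<omega> > x} < prob {\<omega>\<in>space P. X \<omega> > x}"
    using strict_gap[OF acts_measurable[OF X] acts_measurable[OF Y] ge gt] by blast
  have "AE \<omega> in P. X \<omega> \<ge> Y \<omega>"
    using ge by (subst (asm) prob_Collect_eq_1) auto
  then have "prob {\<omega>\<in>space P. Y \<omega> > x} \<le> prob {\<omega>\<in>space P. X \<omega> > x}" for x
    by (intro finite_measure_mono_AE) auto
  then have "survival M (g \<circ> \<nu>) Y x \<le> survival M (g \<circ> \<nu>) X x" for x
    unfolding representation_survival[OF X] representation_survival[OF Y]
    using strict_mono_on_leD[OF representation_strict_mono(1)] by simp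
  moreover have "survival M (g \<circ> \<nu>) Y x < survival M (g \<circ> \<nu>) X x" if "q < x" "x < r" for x
    unfolding representation_survival[OF X] representation_survival[OF Y]
    using strict_mono_onD[OF representation_strict_mono(1)] qr(2)[OF that] by simp
  ultimately have "choquet_integral M (g \<circ> \<nu>) Y < choquet_integral M (g \<circ> \<nu>) X"
    by (intro choquet_strict_mono_survival[OF continuous_capacity_capacity[OF representation_capacity]
          subalgebra_acts[OF sub X] subalgebra_acts[OF sub Y] _ qr(1)])
  then show "strictly_preferred pref X Y"
    unfolding strictly_preferred_def using X Y by (simp add: representation_pref subalgebra_acts[OF sub])
qed

lemma representation_C: "axiom_C M pref"
proof -
  have lim: "(\<lambda>n. choquet_integral M (g \<circ> \<nu>) (Xs n)) \<longlonglongrightarrow> choquet_integral M (g \<circ> \<nu>) X"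
    if Xs: "\<And>n. Xs n \<in> acts M" "X \<in> acts M" "bounded (\<Union>n. Xs n ` space M)"
      "\<forall>\<omega>\<in>space M. (\<lambda>n. Xs n \<omega>) \<longlonglongrightarrow> X \<omega>" for Xs :: "nat \<Rightarrow> _" and X
  proof -
    obtain B where "\<forall>x\<in>(\<Union>n. Xs n ` space M). \<bar>x\<bar> \<le> B"
      using Xs(3) by (auto simp: bounded_real)
    then show ?thesis
      using Xs by (intro choquet_tendsto[OF representation_capacity, where B = B]) (auto intro: acts_measurable)
  qed
  show ?thesis
    unfolding axiom_C_def B_closed_def
  proof (intro ballI conjI allI impI, goal_cases)
    case (1 Y Xs X)
    then have acts: "\<And>n. Xs n \<in> acts M" by blast
    have "choquet_integral M (g \<circ> \<nu>) X \<le> choquet_integral M (g \<circ> \<nu>) Y"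
      by (rule LIMSEQ_le_const2[OF lim[of Xs X]]) (use 1 acts in \<open>auto simp: representation_pref\<close>)
    then show ?case
      using 1 by (simp add: representation_pref)
  next
    case (2 Y Xs X)
    then have acts: "\<And>n. Xs n \<in> acts M" by blast
    have "choquet_integral M (g \<circ> \<nu>) Y \<le> choquet_integral M (g \<circ> \<nu>) X"
      by (rule LIMSEQ_le_const[OF lim[of Xs X]]) (use 2 acts in \<open>auto simp: representation_pref\<close>)
    then show ?case
      using 2 by (simp add: representation_pref)
  qed
qed

lemma representation_CI: "axiom_CI M pref"
  unfolding axiom_CI_def
proof (intro ballI impI)
  fix X Y Z assume acts: "X \<in> acts M" "Y \<in> acts M" "Z \<in> acts M"
    and com: "comonotonic M X Y \<and> comonotonic M X Z \<and> comonotonic M Y Z" and "indifferent pref X Y"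
  then have "choquet_integral M (g \<circ> \<nu>) X = choquet_integral M (g \<circ> \<nu>) Y"
    by (simp add: representation_indifferent)
  then have "choquet_integral M (g \<circ> \<nu>) (\<lambda>\<omega>. (1/2) * X \<omega> + (1/2) * Z \<omega>) =
      choquet_integral M (g \<circ> \<nu>) (\<lambda>\<omega>. (1/2) * Y \<omega> + (1/2) * Z \<omega>)"
    using com by (simp only: choquet_half_sum[OF representation_capacity] acts)
  then show "indifferent pref (\<lambda>\<omega>. (1/2) * X \<omega> + (1/2) * Z \<omega>) (\<lambda>\<omega>. (1/2) * Y \<omega> + (1/2) * Z \<omega>)"
    by (intro representation_indifferent[THEN iffD2] add_acts scale_acts acts)
qed

lemma representation_indicator:
  "A \<in> sets M \<Longrightarrow> choquet_integral M (g \<circ> \<nu>) (indicator A) = g (\<nu> A)"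
  using choquet_indicator[OF continuous_capacity_capacity[OF representation_capacity]] by simp

text \<open>Identifies \<open>g (\<nu> A)\<close> as the certainty equivalent of the indicator, a
  number determined by the preference alone; this is what makes \<open>g\<close> unique.\<close>

lemma representation_indicator_const:
  "A \<in> sets M \<Longrightarrow> indifferent pref (indicator A) (\<lambda>_. c) \<longleftrightarrow> g (\<nu> A) = c"
  by (simp add: representation_indifferent indicator_acts representation_indicator
      choquet_const[OF continuous_capacity_capacity[OF representation_capacity]])

lemma representation_bounds: "A \<in> sets M \<Longrightarrow> \<nu> A \<in> {0..1}"
  using rep capacity_bounds[of M \<nu> A] by (auto simp: choquet_representation_def intro: continuous_capacity_capacity)

lemma representation_P: "A \<in> sets P \<Longrightarrow> \<nu> A = prob A"
  using rep by (auto simp: choquet_representation_def risk_conforming_def)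

text \<open>Atomlessness provides an event \<open>R\<close> of probability \<open>\<nu> A\<close>.
  Risk conformity gives \<open>\<nu> R = \<nu> A\<close>, so the two indicators have the same
  integral.\<close>

lemma representation_matching:
  assumes "atomless P"
  shows "matching_probability M P pref \<nu>"
  unfolding matching_probability_def
proof (intro conjI ballI)
  show "\<nu> \<in> sets M \<rightarrow> {0..1}" using representation_bounds by auto
  fix A assume A: "A \<in> sets M"
  then have "0 \<le> \<nu> A" "\<nu> A \<le> prob (space P)"
    using representation_bounds[OF A] by (auto simp: prob_space)
  then obtain R where R: "R \<in> sets P" "prob R = \<nu> A"
    using atomless_obtain[OF assms sets.top] by metis
  then have "R \<in> sets M" using sub by (auto simp: subalgebra_def)
  then have "indifferent pref (indicator A) (indicator R)"
    using A R by (simp add: representation_indifferent indicator_acts representation_indicator representation_P)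
  then show "\<exists>R\<in>sets P. \<nu> A = prob R \<and> indifferent pref (indicator A) (indicator R)"
    using R by metis
qed

text \<open>Indifference of the indicators equates \<open>g (\<nu> A)\<close> with
  \<open>g (\<nu> R)\<close>, and \<open>g\<close> is injective on the unit interval.\<close>

lemma representation_matching_unique:
  assumes "matching_probability M P pref \<nu>'" and A: "A \<in> sets M"
  shows "\<nu>' A = \<nu> A"
proof -
  obtain R where R: "R \<in> sets P" "\<nu>' A = prob R" "indifferent pref (indicator A) (indicator R)"
    using assms by (auto simp: matching_probability_def)
  then have "R \<in> sets M" using sub by (auto simp: subalgebra_def)
  then have "g (\<nu> A) = g (\<nu> R)"
    using A R by (simp add: representation_indifferent indicator_acts representation_indicator)
  then have "\<nu> A = \<nu> R"
    using representation_strict_mono(1) representation_bounds A \<open>R \<in> sets M\<close>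
    by (auto dest!: strict_mono_on_imp_inj_on inj_onD)
  then show ?thesis using R by (simp add: representation_P)
qed

end

text \<open>One capacity is a matching probability, and the other representation admits no matching
  probability but its own capacity. For \<open>g\<close>, an event of probability \<open>t\<close>
  has a single certainty equivalent, equal to both \<open>g t\<close> and
  \<open>g' t\<close>.\<close>

lemma representation_unique:
  assumes "prob_space P" "subalgebra M P" "atomless P"
    and rep: "choquet_representation M P pref g \<nu>" "choquet_representation M P pref g' \<nu>'"
  shows "t \<in> {0..1} \<Longrightarrow> g t = g' t" "A \<in> sets M \<Longrightarrow> \<nu> A = \<nu>' A"
proof -
  interpret prob_space P by fact
  show "\<nu> A = \<nu>' A" if "A \<in> sets M" for A
    using representation_matching_unique[OF assms(1,2) rep(2) representation_matching[OF assms(1,2) rep(1) assms(3)] that] .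
  show "g t = g' t" if "t \<in> {0..1}" for t
  proof -
    have "0 \<le> t" "t \<le> prob (space P)"
      using that by (auto simp: prob_space)
    then obtain R where R: "R \<in> sets P" "prob R = t"
      using atomless_obtain[OF assms(3) sets.top] by metis
    then have "R \<in> sets M" using assms(2) by (auto simp: subalgebra_def)
    then have "g (\<nu> R) = g' (\<nu>' R)"
      using representation_indicator_const[OF assms(1,2) rep(1)] representation_indicator_const[OF assms(1,2) rep(2)]
      by metis
    then show ?thesis
      using R by (simp add: representation_P[OF assms(1,2) rep(1)] representation_P[OF assms(1,2) rep(2)])
  qed
qed

section \<open>Comonotonically additive functionals are Choquet integrals\<close>

lemma comonotonicI:
  assumes "\<And>\<omega> \<omega>'. \<omega> \<in> space M \<Longrightarrow> \<omega>' \<in> space M \<Longrightarrow> X \<omega> \<le> (X \<omega>' :: real) \<Longrightarrow> F \<omega> \<le> F \<omega>'"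
    and "\<And>\<omega> \<omega>'. \<omega> \<in> space M \<Longrightarrow> \<omega>' \<in> space M \<Longrightarrow> X \<omega> \<le> X \<omega>' \<Longrightarrow> H \<omega> \<le> H \<omega>'"
  shows "comonotonic M F H"
  unfolding comonotonic_def
proof (intro ballI)
  fix \<omega> \<omega>' assume \<omega>: "\<omega> \<in> space M" "\<omega>' \<in> space M"
  show "0 \<le> (F \<omega> - F \<omega>') * (H \<omega> - H \<omega>')"
  proof (cases "X \<omega> \<le> X \<omega>'")
    case True
    then show ?thesis using assms[OF \<omega>] by (intro mult_nonpos_nonpos) auto
  next
    case False
    then show ?thesis using assms[OF \<omega>(2,1)] by (intro mult_nonneg_nonneg) auto
  qed
qed

text \<open>The sum counts the integers \<open>1, ..., K\<close> strictly below \<open>y\<close>,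
  which rounds \<open>y\<close> down with error at most 1. The case \<open>y > real K\<close> is
  carried along because the induction passes through it when
  \<open>K < y \<le> K + 1\<close>.\<close>

lemma sum_levels_approx:
  fixes y :: real
  assumes "0 \<le> y"
  shows "(y > real K \<longrightarrow> (\<Sum>k<K. of_bool (real (Suc k) < y)) = real K) \<and>
    (y \<le> real K \<longrightarrow> y - 1 \<le> (\<Sum>k<K. of_bool (real (Suc k) < y)) \<and>
      (\<Sum>k<K. of_bool (real (Suc k) < y)) \<le> y)"
  using assms by (induction K) (auto simp del: sum_of_bool_eq)

text \<open>The common properties of the Choquet integral and the certainty equivalent. They
  determine the functional on acts by its values on indicators, so two instances can be compared
  there.\<close>

locale comonotonic_functional =
  fixes M :: "'a measure" and J :: "('a \<Rightarrow> real) \<Rightarrow> real"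
  assumes add: "\<And>X Z. X \<in> acts M \<Longrightarrow> Z \<in> acts M \<Longrightarrow> comonotonic M X Z \<Longrightarrow>
      J (\<lambda>\<omega>. X \<omega> + Z \<omega>) = J X + J Z"
    and lim: "\<And>Xs X B. (\<And>n::nat. Xs n \<in> acts M) \<Longrightarrow> X \<in> acts M \<Longrightarrow>
      (\<And>n \<omega>. \<omega> \<in> space M \<Longrightarrow> \<bar>Xs n \<omega>\<bar> \<le> B) \<Longrightarrow>
      (\<And>\<omega>. \<omega> \<in> space M \<Longrightarrow> (\<lambda>n. Xs n \<omega>) \<longlonglongrightarrow> X \<omega>) \<Longrightarrow> (\<lambda>n. J (Xs n)) \<longlonglongrightarrow> J X"
    and const: "\<And>c. J (\<lambda>_. c) = c"
begin

lemma scale_nat: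
  assumes "X \<in> acts M"
  shows "J (\<lambda>\<omega>. real j * X \<omega>) = real j * J X"
proof (induction j)
  case 0
  then show ?case using const[of 0] by simp
next
  case (Suc j)
  have "J (\<lambda>\<omega>. real j * X \<omega> + X \<omega>) = J (\<lambda>\<omega>. real j * X \<omega>) + J X"
    by (intro add scale_acts assms comonotonicI[of M X]) (auto intro: mult_left_mono)
  moreover have "(\<lambda>\<omega>. real (Suc j) * X \<omega>) = (\<lambda>\<omega>. real j * X \<omega> + X \<omega>)"
    by (simp add: algebra_simps)
  ultimately show ?case
    using Suc by (simp add: algebra_simps)
qed

lemma scale_inverse_nat:
  assumes "X \<in> acts M"
  shows "J (\<lambda>\<omega>. (1 / real (Suc n)) * X \<omega>) = (1 / real (Suc n)) * J X"
proof -
  have "(\<lambda>\<omega>. real (Suc n) * ((1 / real (Suc n)) * X \<omega>)) = X"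
    by (auto simp del: of_nat_Suc)
  then have "J X = real (Suc n) * J (\<lambda>\<omega>. (1 / real (Suc n)) * X \<omega>)"
    using scale_nat[OF scale_acts[OF assms, of "1 / real (Suc n)"], of "Suc n"] by simp
  then show ?thesis by (simp del: of_nat_Suc)
qed

text \<open>The level sets \<open>A k\<close> are nested along \<open>X\<close>: every summand and
  every partial sum increases with \<open>X\<close>, so they are comonotonic and \<open>J\<close>
  splits off one summand at a time. Membership in \<open>acts M\<close> is proved in the same
  induction because each use of additivity requires it.\<close>

lemma lower_sums:
  assumes X: "X \<in> acts M" and A: "\<And>k. A k = {\<omega>\<in>space M. real (Suc k) < real (Suc n) * (X \<omega> + B)}"
  shows "(\<lambda>\<omega>. - B + (\<Sum>k<K. (1 / real (Suc n)) * indicator (A k) \<omega>)) \<in> acts M"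
    and "J (\<lambda>\<omega>. - B + (\<Sum>k<K. (1 / real (Suc n)) * indicator (A k) \<omega>)) =
      - B + (\<Sum>k<K. (1 / real (Suc n)) * J (indicator (A k)))"
proof -
  note [measurable] = acts_measurable[OF X]
  have ind: "indicator (A k) \<in> acts M" for k
    unfolding A by (intro indicator_acts) measurable
  have mono: "(1 / real (Suc n)) * indicator (A k) \<omega> \<le> (1 / real (Suc n)) * indicator (A k) \<omega>'"
    if "\<omega> \<in> space M" "\<omega>' \<in> space M" "X \<omega> \<le> X \<omega>'" for \<omega> \<omega>' k
  proof (rule mult_left_mono)
    have le: "real (Suc n) * (X \<omega> + B) \<le> real (Suc n) * (X \<omega>' + B)"
      using that by (intro mult_left_mono) auto
    have "\<omega>' \<in> A k" if "\<omega> \<in> A k"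
      using that \<open>\<omega>' \<in> space M\<close> less_le_trans[OF _ le] unfolding A by blast
    then show "indicator (A k) \<omega> \<le> (indicator (A k) \<omega>' :: real)"
      by (simp add: indicator_def)
  qed simp
  have "(\<lambda>\<omega>. - B + (\<Sum>k<K. (1 / real (Suc n)) * indicator (A k) \<omega>)) \<in> acts M \<and>
    J (\<lambda>\<omega>. - B + (\<Sum>k<K. (1 / real (Suc n)) * indicator (A k) \<omega>)) =
      - B + (\<Sum>k<K. (1 / real (Suc n)) * J (indicator (A k)))"
  proof (induction K)
    case 0
    then show ?case using const by simp
  next
    case (Suc K)
    let ?T = "\<lambda>\<omega>. - B + (\<Sum>k<K. (1 / real (Suc n)) * indicator (A k) \<omega>)"
    let ?U = "\<lambda>\<omega>. (1 / real (Suc n)) * indicator (A K) \<omega>"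
    have eq: "(\<lambda>\<omega>. - B + (\<Sum>k<Suc K. (1 / real (Suc n)) * indicator (A k) \<omega>)) = (\<lambda>\<omega>. ?T \<omega> + ?U \<omega>)"
      by (simp add: algebra_simps)
    have U: "?U \<in> acts M" by (intro scale_acts ind)
    have T: "?T \<in> acts M" using Suc.IH by (rule conjunct1)
    have "comonotonic M ?T ?U"
      by (intro comonotonicI[of M X] add_mono sum_mono mono order_refl)
    then have "J (\<lambda>\<omega>. ?T \<omega> + ?U \<omega>) = J ?T + J ?U"
      by (intro add T U)
    also have "\<dots> = - B + (\<Sum>k<Suc K. (1 / real (Suc n)) * J (indicator (A k)))"
      unfolding scale_inverse_nat[OF ind] conjunct2[OF Suc.IH] by (simp del: of_nat_Suc)
    finally show ?case
      unfolding eq using add_acts[OF T U] by blast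
  qed
  then show "(\<lambda>\<omega>. - B + (\<Sum>k<K. (1 / real (Suc n)) * indicator (A k) \<omega>)) \<in> acts M"
    and "J (\<lambda>\<omega>. - B + (\<Sum>k<K. (1 / real (Suc n)) * indicator (A k) \<omega>)) =
      - B + (\<Sum>k<K. (1 / real (Suc n)) * J (indicator (A k)))"
    by blast+
qed

lemma lower_sums_tendsto:
  assumes X: "X \<in> acts M" and B: "\<And>\<omega>. \<omega> \<in> space M \<Longrightarrow> \<bar>X \<omega>\<bar> \<le> B"
    and A: "\<And>n k. A n k = {\<omega>\<in>space M. real (Suc k) < real (Suc n) * (X \<omega> + B)}"
  shows "(\<lambda>n. - B + (\<Sum>k<nat \<lceil>2 * B * real (Suc n)\<rceil>. (1 / real (Suc n)) * J (indicator (A n k)))) \<longlonglongrightarrow> J X"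
proof -
  \<comment> \<open>\<open>X + B\<close> lies in \<open>[0, 2 * B]\<close>, so with this many levels
    of spacing \<open>1 / real (Suc n)\<close> the whole range of \<open>X\<close> is
    covered.\<close>
  define K where "K n = nat \<lceil>2 * B * real (Suc n)\<rceil>" for n
  define Y where "Y n \<omega> = - B + (\<Sum>k<K n. (1 / real (Suc n)) * indicator (A n k) \<omega>)" for n \<omega>
  have Y: "Y n \<in> acts M" "J (Y n) = - B + (\<Sum>k<K n. (1 / real (Suc n)) * J (indicator (A n k)))" for n
    unfolding Y_def by (intro lower_sums[OF X A])+
  \<comment> \<open>After rescaling by \<open>Suc n\<close> the indicators count the levels below
    \<open>?y\<close>, with an error of at most 1. Dividing back gives a uniform error of one
    spacing.\<close>
  have close: "\<bar>Y n \<omega> - X \<omega>\<bar> \<le> 1 / real (Suc n)" if \<omega>: "\<omega> \<in> space M" for n \<omega>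
  proof -
    let ?y = "real (Suc n) * (X \<omega> + B)"
    let ?s = "\<Sum>k<K n. of_bool (real (Suc k) < ?y) :: real"
    have "0 \<le> ?y" using B[OF \<omega>] by simp
    have "?y \<le> real (Suc n) * (2 * B)"
      using B[OF \<omega>] by (intro mult_left_mono) auto
    also have "\<dots> \<le> real (K n)"
      unfolding K_def using real_nat_ceiling_ge[of "2 * B * real (Suc n)"] by (simp only: mult_ac)
    finally have s: "?y - 1 \<le> ?s" "?s \<le> ?y"
      using sum_levels_approx[OF \<open>0 \<le> ?y\<close>, of "K n"] by auto
    have "Y n \<omega> = - B + ?s / real (Suc n)"
      unfolding Y_def A sum_distrib_left[symmetric] using \<omega>
      by (simp add: indicator_def del: of_nat_Suc)
    moreover have "?y / real (Suc n) = X \<omega> + B" "(?y - 1) / real (Suc n) = X \<omega> + B - 1 / real (Suc n)"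
      by (simp_all add: diff_divide_distrib del: of_nat_Suc)
    moreover have "(?y - 1) / real (Suc n) \<le> ?s / real (Suc n)" "?s / real (Suc n) \<le> ?y / real (Suc n)"
      using s by (intro divide_right_mono; simp)+
    ultimately show ?thesis
      by (simp add: abs_le_iff del: of_nat_Suc)
  qed
  have "(\<lambda>n. J (Y n)) \<longlonglongrightarrow> J X"
  proof (rule lim[where B = "B + 1", OF Y(1) X])
    fix n \<omega> assume \<omega>: "\<omega> \<in> space M"
    have "1 / real (Suc n) \<le> 1" by simp
    with close[OF \<omega>, of n] B[OF \<omega>] show "\<bar>Y n \<omega>\<bar> \<le> B + 1" by linarith
  next
    fix \<omega> assume \<omega>: "\<omega> \<in> space M"
    have "(\<lambda>n. Y n \<omega> - X \<omega>) \<longlonglongrightarrow> 0"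
      by (rule Lim_null_comparison[OF _ LIMSEQ_inverse_real_of_nat])
        (use close[OF \<omega>] in \<open>auto simp: inverse_eq_divide\<close>)
    then show "(\<lambda>n. Y n \<omega>) \<longlonglongrightarrow> X \<omega>" by (simp add: LIM_zero_iff)
  qed
  then show ?thesis
    unfolding Y K_def .
qed

end

lemma choquet_comonotonic_functional:
  assumes cc: "continuous_capacity M \<mu>"
  shows "comonotonic_functional M (choquet_integral M \<mu>)"
proof
  show "(\<lambda>n. choquet_integral M \<mu> (Xs n)) \<longlonglongrightarrow> choquet_integral M \<mu> X"
    if "\<And>n::nat. Xs n \<in> acts M" "X \<in> acts M" "\<And>n \<omega>. \<omega> \<in> space M \<Longrightarrow> \<bar>Xs n \<omega>\<bar> \<le> B"
      "\<And>\<omega>. \<omega> \<in> space M \<Longrightarrow> (\<lambda>n. Xs n \<omega>) \<longlonglongrightarrow> X \<omega>" for Xs X B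
    using that by (intro choquet_tendsto[OF cc]) (auto intro: acts_measurable)
qed (auto simp: choquet_comonotonic_add[OF cc] choquet_const continuous_capacity_capacity[OF cc])

text \<open>\<open>J\<close> and the Choquet integral agree on the indicators of level sets, and
  both values at \<open>X\<close> are limits of the same sums over these indicators.\<close>

lemma (in comonotonic_functional) eq_choquet:
  assumes cc: "continuous_capacity M (\<lambda>A. J (indicator A))" and X: "X \<in> acts M"
  shows "J X = choquet_integral M (\<lambda>A. J (indicator A)) X"
proof -
  interpret C: comonotonic_functional M "choquet_integral M (\<lambda>A. J (indicator A))"
    by (rule choquet_comonotonic_functional[OF cc])
  obtain B where B: "\<And>\<omega>. \<omega> \<in> space M \<Longrightarrow> \<bar>X \<omega>\<bar> \<le> B"
    using X by (metis actsE)
  define A where "A n k = {\<omega>\<in>space M. real (Suc k) < real (Suc n) * (X \<omega> + B)}" for n k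
  note [measurable] = acts_measurable[OF X]
  have "A n k \<in> sets M" for n k
    unfolding A_def by measurable
  then have "choquet_integral M (\<lambda>A. J (indicator A)) (indicator (A n k)) = J (indicator (A n k))" for n k
    by (intro choquet_indicator continuous_capacity_capacity cc)
  then show ?thesis
    using LIMSEQ_unique[OF lower_sums_tendsto[OF X B A_def]] C.lower_sums_tendsto[OF X B A_def] by simp
qed

section \<open>The axioms yield a representation\<close>

locale choquet_axioms = prob_space P for P :: "'a measure" +
  fixes M :: "'a measure" and pref :: "'a pref"
  assumes sub: "subalgebra M P" and atomless: "atomless P" and preference: "preference_relation M pref"
    and RC: "axiom_RC P pref" and M: "axiom_M M pref" and SRM: "axiom_SRM P pref"
    and C: "axiom_C M pref" and CI: "axiom_CI M pref"
begin

lemma pref_trans: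
  "pref X Y \<Longrightarrow> pref Y Z \<Longrightarrow> X \<in> acts M \<Longrightarrow> Y \<in> acts M \<Longrightarrow> Z \<in> acts M \<Longrightarrow> pref X Z"
  using preference unfolding preference_relation_def by (blast dest: transp_onD)

lemma pref_total: "X \<in> acts M \<Longrightarrow> Y \<in> acts M \<Longrightarrow> pref X Y \<or> pref Y X"
  using preference unfolding preference_relation_def by (cases "X = Y") (blast dest: totalp_onD reflp_onD)+

lemma pref_mono: "X \<in> acts M \<Longrightarrow> Y \<in> acts M \<Longrightarrow> (\<And>\<omega>. \<omega> \<in> space M \<Longrightarrow> Y \<omega> \<le> X \<omega>) \<Longrightarrow> pref X Y"
  using M unfolding axiom_M_def by blast

text \<open>Monotonicity orders the constants weakly. As they are measurable for \<open>P\<close>,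
  (SRM) makes the order strict.\<close>

lemma pref_const_iff: "pref (\<lambda>_. c) (\<lambda>_. d) \<longleftrightarrow> d \<le> c"
proof
  show "pref (\<lambda>_. c) (\<lambda>_. d)" if "d \<le> c"
    using that by (intro pref_mono) auto
  show "d \<le> c" if "pref (\<lambda>_. c) (\<lambda>_. d)"
  proof (rule ccontr)
    assume "\<not> d \<le> c"
    then have "prob {\<omega>\<in>space P. c \<le> d} = 1 \<and> prob {\<omega>\<in>space P. c < d} > 0"
      by (simp add: prob_space)
    then have "strictly_preferred pref (\<lambda>_. d) (\<lambda>_. c)"
      using SRM[unfolded axiom_SRM_def, rule_format, of "\<lambda>_. d" "\<lambda>_. c"] by simp
    then show False
      using that unfolding strictly_preferred_def by blast
  qed
qed

lemma pref_limit:
  assumes "Y \<in> acts M" "X \<in> acts M" and Xs: "\<And>n::nat. Xs n \<in> acts M"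
    and B: "\<And>n \<omega>. \<omega> \<in> space M \<Longrightarrow> \<bar>Xs n \<omega>\<bar> \<le> B"
    and lim: "\<And>\<omega>. \<omega> \<in> space M \<Longrightarrow> (\<lambda>n. Xs n \<omega>) \<longlonglongrightarrow> X \<omega>"
  shows "(\<And>n. pref Y (Xs n)) \<Longrightarrow> pref Y X" "(\<And>n. pref (Xs n) Y) \<Longrightarrow> pref X Y"
proof -
  have bounded: "bounded (\<Union>n. Xs n ` space M)"
    using B unfolding bounded_real by blast
  have closed: "B_closed M {Z\<in>acts M. pref Y Z}" "B_closed M {Z\<in>acts M. pref Z Y}"
    using C assms(1) unfolding axiom_C_def by blast+
  show "pref Y X" if "\<And>n. pref Y (Xs n)"
    using closed(1) that bounded lim Xs assms(2) unfolding B_closed_def by blast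
  show "pref X Y" if "\<And>n. pref (Xs n) Y"
    using closed(2) that bounded lim Xs assms(2) unfolding B_closed_def by blast
qed

section \<open>Certainty equivalents and their continuity\<close>

lemma pref_const_limit:
  assumes "X \<in> acts M" "x \<longlonglongrightarrow> (l :: real)"
  shows "(\<And>n. pref X (\<lambda>_. x n)) \<Longrightarrow> pref X (\<lambda>_. l)" "(\<And>n. pref (\<lambda>_. x n) X) \<Longrightarrow> pref (\<lambda>_. l) X"
proof -
  obtain B where "\<And>n. \<bar>x n\<bar> \<le> B"
    using convergent_imp_Bseq[of x] assms(2) by (metis BseqE convergentI real_norm_def)
  then show "(\<And>n. pref X (\<lambda>_. x n)) \<Longrightarrow> pref X (\<lambda>_. l)" "(\<And>n. pref (\<lambda>_. x n) X) \<Longrightarrow> pref (\<lambda>_. l) X"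
    using pref_limit[OF assms(1), of "\<lambda>_. l" "\<lambda>n _. x n" B] assms(2) by simp_all
qed

text \<open>The constants at least as good as \<open>X\<close> and those at most as good form closed
  sets covering \<open>[-B, B]\<close>. Each contains an endpoint, so connectedness makes them
  meet.\<close>

lemma certainty_equivalent_ex:
  assumes X: "X \<in> acts M"
  obtains c where "indifferent pref X (\<lambda>_. c)"
proof -
  define S where "S = {c. pref (\<lambda>_. c) X}"
  define T where "T = {c. pref X (\<lambda>_. c)}"
  obtain B where B: "\<And>\<omega>. \<omega> \<in> space M \<Longrightarrow> \<bar>X \<omega>\<bar> \<le> B" and "B > 0"
    using X by (metis actsE)
  have "closed S" "closed T"
    unfolding closed_sequential_limits S_def T_def using pref_const_limit[OF X] by blast+
  moreover have "{-B..B} \<subseteq> S \<union> T"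
    unfolding S_def T_def using pref_total[OF X const_acts] by blast
  moreover have "B \<in> S" "- B \<in> T"
    unfolding S_def T_def mem_Collect_eq using abs_le_D1[OF B] minus_le_iff[THEN iffD1, OF abs_le_D2[OF B]]
    by (auto intro!: pref_mono X)
  then have "S \<inter> {-B..B} \<noteq> {}" "T \<inter> {-B..B} \<noteq> {}"
    using \<open>B > 0\<close> by auto
  moreover have "connected {-B..B}" by simp
  ultimately have "S \<inter> T \<inter> {-B..B} \<noteq> {}"
    unfolding connected_closed by blast
  then show thesis
    using that unfolding S_def T_def indifferent_def by blast
qed

text \<open>For an act the choice is forced, since distinct constants are never indifferent.\<close>

definition ce :: "('a \<Rightarrow> real) \<Rightarrow> real" where
  "ce X = (SOME c. indifferent pref X (\<lambda>_. c))"

lemma indifferent_ce: "X \<in> acts M \<Longrightarrow> indifferent pref X (\<lambda>_. ce X)"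
  unfolding ce_def by (metis certainty_equivalent_ex someI_ex)

lemma pref_iff_ce:
  assumes "X \<in> acts M" "Y \<in> acts M"
  shows "pref X Y \<longleftrightarrow> ce Y \<le> ce X"
proof -
  have "pref X Y \<longleftrightarrow> pref (\<lambda>_. ce X) (\<lambda>_. ce Y)"
    using indifferent_ce[OF assms(1)] indifferent_ce[OF assms(2)] assms const_acts[of "ce X" M] const_acts[of "ce Y" M]
    unfolding indifferent_def by (meson pref_trans)
  then show ?thesis by (simp add: pref_const_iff)
qed

lemma indifferent_iff_ce:
  "X \<in> acts M \<Longrightarrow> Y \<in> acts M \<Longrightarrow> indifferent pref X Y \<longleftrightarrow> ce X = ce Y"
  unfolding indifferent_def by (auto simp: pref_iff_ce)

lemma ce_const [simp]: "ce (\<lambda>_. c) = c"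
  using indifferent_ce[of "\<lambda>_. c"] unfolding indifferent_def by (simp add: pref_const_iff)

lemma ce_mono:
  "X \<in> acts M \<Longrightarrow> Y \<in> acts M \<Longrightarrow> (\<And>\<omega>. \<omega> \<in> space M \<Longrightarrow> Y \<omega> \<le> X \<omega>) \<Longrightarrow> ce Y \<le> ce X"
  using pref_mono pref_iff_ce by blast

lemma ce_tendsto:
  assumes Xs: "\<And>n::nat. Xs n \<in> acts M" and X: "X \<in> acts M"
    and B: "\<And>n \<omega>. \<omega> \<in> space M \<Longrightarrow> \<bar>Xs n \<omega>\<bar> \<le> B"
    and lim: "\<And>\<omega>. \<omega> \<in> space M \<Longrightarrow> (\<lambda>n. Xs n \<omega>) \<longlonglongrightarrow> X \<omega>"
  shows "(\<lambda>n. ce (Xs n)) \<longlonglongrightarrow> ce X"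
proof (rule order_tendstoI)
  \<comment> \<open>If an eventual bound failed, the reverse inequality would hold along a
    subsequence. That subsequence still converges to \<open>X\<close>, so closedness would carry the
    inequality over to \<open>X\<close>.\<close>
  have subseq: "\<exists>r :: nat \<Rightarrow> nat. strict_mono r \<and> (\<forall>n. \<not> Q (r n))" if "\<not> eventually Q sequentially" for Q
  proof -
    have "infinite {n. \<not> Q n}"
      using that by (simp add: eventually_cofinite flip: cofinite_eq_sequentially)
    then show ?thesis
      using infinite_enumerate[of "{n. \<not> Q n}"] by simp
  qed
  have sublim: "(\<lambda>n. Xs (r n) \<omega>) \<longlonglongrightarrow> X \<omega>" if "strict_mono r" "\<omega> \<in> space M" for r \<omega>
    using LIMSEQ_subseq_LIMSEQ[OF lim that(1)] that(2) by (simp add: o_def)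
  show "\<forall>\<^sub>F n in sequentially. a < ce (Xs n)" if "a < ce X" for a
  proof (rule ccontr)
    assume "\<not> ?thesis"
    from subseq[OF this] obtain r :: "nat \<Rightarrow> nat" where r: "strict_mono r" "\<And>n. ce (Xs (r n)) \<le> a"
      unfolding not_less by blast
    have "pref (\<lambda>_. a) X"
      using r by (intro pref_limit(1)[of "\<lambda>_. a" X "\<lambda>n. Xs (r n)" B] X Xs B sublim) (auto simp: pref_iff_ce Xs)
    then show False using that X by (simp add: pref_iff_ce)
  qed
  show "\<forall>\<^sub>F n in sequentially. ce (Xs n) < a" if "ce X < a" for a
  proof (rule ccontr)
    assume "\<not> ?thesis"
    from subseq[OF this] obtain r :: "nat \<Rightarrow> nat" where r: "strict_mono r" "\<And>n. a \<le> ce (Xs (r n))"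
      unfolding not_less by blast
    have "pref X (\<lambda>_. a)"
      using r by (intro pref_limit(2)[of "\<lambda>_. a" X "\<lambda>n. Xs (r n)" B] X Xs B sublim) (auto simp: pref_iff_ce Xs)
    then show False using that X by (simp add: pref_iff_ce)
  qed
qed

section \<open>Comonotonic additivity of the certainty equivalent\<close>

lemma ce_cancel:
  assumes acts: "X \<in> acts M" "Y \<in> acts M" "Z \<in> acts M"
    and "comonotonic M X Y" "comonotonic M X Z" "comonotonic M Y Z" "ce X = ce Y"
  shows "ce (\<lambda>\<omega>. (1/2) * X \<omega> + (1/2) * Z \<omega>) = ce (\<lambda>\<omega>. (1/2) * Y \<omega> + (1/2) * Z \<omega>)"
proof -
  have "indifferent pref X Y"
    using acts assms(7) by (simp add: indifferent_iff_ce)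
  then have "indifferent pref (\<lambda>\<omega>. (1/2) * X \<omega> + (1/2) * Z \<omega>) (\<lambda>\<omega>. (1/2) * Y \<omega> + (1/2) * Z \<omega>)"
    using CI assms unfolding axiom_CI_def by blast
  then show ?thesis
    by (intro indifferent_iff_ce[THEN iffD1] add_acts scale_acts acts)
qed

lemma comonotonic_const: "comonotonic M X (\<lambda>_. c)" "comonotonic M (\<lambda>_. c) X"
  by (simp_all add: comonotonic_def)

text \<open>Comonotonic independence lets both acts be replaced by their certainty equivalents.\<close>

lemma ce_midpoint:
  assumes X: "X \<in> acts M" and Z: "Z \<in> acts M" and com: "comonotonic M X Z"
  shows "ce (\<lambda>\<omega>. (1/2) * X \<omega> + (1/2) * Z \<omega>) = (ce X + ce Z) / 2"
proof -
  have "ce (\<lambda>\<omega>. (1/2) * X \<omega> + (1/2) * Z \<omega>) = ce (\<lambda>\<omega>. (1/2) * ce X + (1/2) * Z \<omega>)"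
    by (rule ce_cancel[of X "\<lambda>_. ce X"]) (simp_all add: X Z com comonotonic_const)
  also have "\<dots> = ce (\<lambda>\<omega>. (1/2) * Z \<omega> + (1/2) * ce X)"
    by (simp add: add.commute)
  also have "\<dots> = ce (\<lambda>\<omega>. (1/2) * ce Z + (1/2) * ce X)"
    by (rule ce_cancel[of Z "\<lambda>_. ce Z" "\<lambda>_. ce X"]) (simp_all add: Z comonotonic_const)
  finally show ?thesis by simp
qed

text \<open>\<open>X\<close> is the midpoint of \<open>2 * X\<close> and the constant 0.\<close>

lemma ce_double:
  assumes "X \<in> acts M"
  shows "ce (\<lambda>\<omega>. 2 * X \<omega>) = 2 * ce X"
  using ce_midpoint[OF scale_acts[OF assms, of 2] const_acts[of 0] comonotonic_const(1)] by simp

text \<open>\<open>X + Z\<close> is the midpoint of the comonotonic acts \<open>2 * X\<close> and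
  \<open>2 * Z\<close>.\<close>

lemma ce_add:
  assumes X: "X \<in> acts M" and Z: "Z \<in> acts M" and com: "comonotonic M X Z"
  shows "ce (\<lambda>\<omega>. X \<omega> + Z \<omega>) = ce X + ce Z"
  using ce_midpoint[OF scale_acts[OF X, of 2] scale_acts[OF Z, of 2] comonotonic_scale[OF com]]
  by (simp add: ce_double X Z)

sublocale ce_functional: comonotonic_functional M ce
  by unfold_locales (fact ce_add ce_tendsto ce_const)+

section \<open>The capacity induced by certainty equivalents\<close>

definition \<mu> :: "'a set \<Rightarrow> real" where
  "\<mu> A = ce (indicator A)"

lemma space_eq: "space P = space M" and sets_subset: "A \<in> sets P \<Longrightarrow> A \<in> sets M"
  using sub by (auto simp: subalgebra_def)

text \<open>Indicators of a monotone sequence of sets converge pointwise and are bounded by 1, so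
  continuity of \<open>\<mu>\<close> is a special case of that of \<open>ce\<close>.\<close>

lemma \<mu>_continuous_capacity: "continuous_capacity M \<mu>"
proof -
  have "\<mu> {} = 0"
    unfolding \<mu>_def using ce_const[of 0] by (simp add: indicator_def[abs_def] del: ce_const)
  moreover have "\<mu> (space M) = 1"
  proof -
    have "ce (indicator (space M)) = ce (\<lambda>_. 1)"
      by (intro order.antisym ce_mono indicator_acts const_acts sets.top) auto
    then show ?thesis by (simp add: \<mu>_def)
  qed
  moreover have "\<mu> A \<le> \<mu> B" if "A \<in> sets M" "B \<in> sets M" "A \<subseteq> B" for A B
    unfolding \<mu>_def using that by (intro ce_mono indicator_acts) (auto simp: indicator_def)
  moreover have "(\<lambda>n. \<mu> (A n)) \<longlonglongrightarrow> \<mu> (\<Union>n. A n)" if "range A \<subseteq> sets M" "incseq A" for A :: "nat \<Rightarrow> _"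
    unfolding \<mu>_def
    by (rule ce_tendsto[where B = 1]; (intro indicator_acts LIMSEQ_indicator_incseq that)?)
      (use that in \<open>auto simp: indicator_def\<close>)
  moreover have "(\<lambda>n. \<mu> (A n)) \<longlonglongrightarrow> \<mu> (\<Inter>n. A n)" if "range A \<subseteq> sets M" "decseq A" for A :: "nat \<Rightarrow> _"
    unfolding \<mu>_def
    by (rule ce_tendsto[where B = 1]; (intro indicator_acts LIMSEQ_indicator_decseq that)?)
      (use that in \<open>auto simp: indicator_def\<close>)
  ultimately show ?thesis
    unfolding continuous_capacity_def capacity_def by blast
qed

lemma ce_eq_choquet: "X \<in> acts M \<Longrightarrow> ce X = choquet_integral M \<mu> X"
  using ce_functional.eq_choquet \<mu>_continuous_capacity by (simp add: \<mu>_def[abs_def])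

section \<open>The distortion function read off from events of given probability\<close>

definition g :: "real \<Rightarrow> real" where
  "g t = \<mu> (SOME R. R \<in> sets P \<and> prob R = t)"

text \<open>Indicators of equally likely events have the same tails, so (RC) applies. The event
  chosen in the definition of \<open>g\<close> is therefore immaterial.\<close>

lemma \<mu>_law_invariant:
  assumes "R \<in> sets P" "S \<in> sets P" "prob R = prob S"
  shows "\<mu> R = \<mu> S"
proof -
  have "{\<omega>\<in>space P. indicator R \<omega> > x} = (if x < 0 then space P else if x < 1 then R else {})"
    if "R \<in> sets P" for R and x :: real
    using sets.sets_into_space[OF that] by (auto simp: indicator_def split: if_splits)
  then have "\<forall>x. prob {\<omega>\<in>space P. indicator R \<omega> > x} = prob {\<omega>\<in>space P. indicator S \<omega> > (x::real)}"
    using assms by simp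
  then have "indifferent pref (indicator R) (indicator S)"
    using RC assms unfolding axiom_RC_def by (meson indicator_acts)
  then show ?thesis
    using assms by (simp add: \<mu>_def indifferent_iff_ce indicator_acts sets_subset)
qed

lemma g_prob: "R \<in> sets P \<Longrightarrow> g (prob R) = \<mu> R"
  unfolding g_def using someI[of "\<lambda>S. S \<in> sets P \<and> prob S = prob R" R] by (intro \<mu>_law_invariant) auto

lemma obtain_prob:
  assumes "t \<in> {0..1}"
  obtains R where "R \<in> sets P" "prob R = t"
  using assms atomless_obtain[OF atomless sets.top, of t] prob_space by (metis atLeastAtMost_iff)

text \<open>Atomlessness realises \<open>s < t\<close> by nested events, whose indicators are
  comparable pointwise and differ with probability \<open>t - s\<close>, as (SRM) demands.\<close>

lemma g_strict_mono: "strict_mono_on {0..1} g"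
proof (rule strict_mono_onI)
  fix s t :: real assume st: "s \<in> {0..1}" "t \<in> {0..1}" "s < t"
  obtain R where R: "R \<in> sets P" "prob R = t"
    using obtain_prob[OF st(2)] by blast
  obtain S where S: "S \<in> sets P" "S \<subseteq> R" "prob S = s"
    using atomless_obtain[OF atomless R(1), of s] R(2) st by auto
  have "{\<omega>\<in>space P. indicator S \<omega> \<le> (indicator R \<omega> :: real)} = space P"
    using S by (auto simp: indicator_def)
  moreover have "{\<omega>\<in>space P. indicator S \<omega> < (indicator R \<omega> :: real)} = R - S"
    using S sets.sets_into_space[OF R(1)] by (auto simp: indicator_def)
  moreover have "prob (R - S) = t - s"
    using R S by (simp add: finite_measure_Diff)
  ultimately have "strictly_preferred pref (indicator R) (indicator S)"
    using SRM R S st unfolding axiom_SRM_def by (simp add: indicator_acts prob_space)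
  then have "\<mu> S < \<mu> R"
    using R S by (auto simp: strictly_preferred_def pref_iff_ce indicator_acts sets_subset \<mu>_def)
  then show "g s < g t"
    using g_prob R S by metis
qed

text \<open>Supplies shrinking events of vanishing probability. Removed from an event or added to
  it, they test \<open>g\<close> from the left and from the right.\<close>

lemma halving:
  assumes "A \<in> sets P"
  obtains D :: "nat \<Rightarrow> 'a set" where "decseq D" "\<And>n. D n \<in> sets P" "\<And>n. D n \<subseteq> A" "\<And>n. prob (D n) = prob A / 2 ^ n"
proof -
  have "\<exists>D. \<forall>n. (D n \<in> sets P \<and> D n \<subseteq> A \<and> prob (D n) = prob A / 2 ^ n) \<and> D (Suc n) \<subseteq> D n"
  proof (rule dependent_nat_choice)
    show "\<exists>B. B \<in> sets P \<and> B \<subseteq> A \<and> prob B = prob A / 2 ^ 0"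
      using assms by auto
    fix B n assume B: "B \<in> sets P \<and> B \<subseteq> A \<and> prob B = prob A / 2 ^ n"
    have "0 \<le> prob B / 2" "prob B / 2 \<le> prob B"
      using measure_nonneg[of P B] by linarith+
    then obtain B' where "B' \<in> sets P" "B' \<subseteq> B" "prob B' = prob B / 2"
      using atomless_obtain[OF atomless conjunct1[OF B]] by blast
    with B show "\<exists>B'. (B' \<in> sets P \<and> B' \<subseteq> A \<and> prob B' = prob A / 2 ^ Suc n) \<and> B' \<subseteq> B"
      by (intro exI[of _ B']) auto
  qed
  then show thesis
    using that by (auto intro: decseq_SucI)
qed

lemma g_left:
  assumes "t \<in> {0..1}"
  shows "(\<lambda>n. g (t - t / 2 ^ n)) \<longlonglongrightarrow> g t"
proof -
  obtain R where R: "R \<in> sets P" "prob R = t"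
    using obtain_prob[OF assms] by blast
  obtain D where D: "decseq D" "\<And>n. D n \<in> sets P" "\<And>n. D n \<subseteq> R" "\<And>n::nat. prob (D n) = t / 2 ^ n"
    using halving[OF R(1)] R(2) by metis
  define E where "E n = R - D n" for n
  have E: "incseq E" "\<And>n. E n \<in> sets P" "\<And>n. prob (E n) = t - t / 2 ^ n"
    using D R unfolding E_def incseq_def decseq_def by (auto simp: finite_measure_Diff)
  have "(\<lambda>n. prob (E n)) \<longlonglongrightarrow> prob (\<Union>n. E n)"
    using E by (intro finite_Lim_measure_incseq) auto
  moreover have "(\<lambda>n. t - t / 2 ^ n) \<longlonglongrightarrow> t - 0"
    by (intro tendsto_diff tendsto_const LIMSEQ_divide_realpow_zero) auto
  ultimately have "prob (\<Union>n. E n) = t"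
    using LIMSEQ_unique unfolding E(3) by fastforce
  \<comment> \<open>The union may miss a null part of \<open>R\<close>, so its value is found from
    its probability rather than from equality with \<open>R\<close>.\<close>
  then have "\<mu> (\<Union>n. E n) = g t"
    using g_prob[of "\<Union>n. E n"] E(2) by auto
  moreover have "\<mu> (E n) = g (t - t / 2 ^ n)" for n
    using g_prob[OF E(2)] E(3) by metis
  ultimately show ?thesis
    using continuous_capacity_incseq[OF \<mu>_continuous_capacity _ E(1)] sets_subset[OF E(2)] by simp
qed

text \<open>Shrinking parts of the complement are added to \<open>R\<close>; continuity of
  \<open>\<mu>\<close> along decreasing sequences takes over the role of increasing ones.\<close>

lemma g_right:
  assumes "t \<in> {0..1}"
  shows "(\<lambda>n. g (t + (1 - t) / 2 ^ n)) \<longlonglongrightarrow> g t"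
proof -
  obtain R where R: "R \<in> sets P" "prob R = t"
    using obtain_prob[OF assms] by blast
  have "prob (space P - R) = 1 - t"
    using R by (simp add: prob_compl)
  then obtain D where D: "decseq D" "\<And>n. D n \<in> sets P" "\<And>n. D n \<subseteq> space P - R" "\<And>n::nat. prob (D n) = (1 - t) / 2 ^ n"
    using halving[OF sets.compl_sets[OF R(1)]] by metis
  define E where "E n = R \<union> D n" for n
  have E: "decseq E" "\<And>n. E n \<in> sets P"
    using D R unfolding E_def decseq_def by auto
  have prob_E: "prob (E n) = t + (1 - t) / 2 ^ n" for n
    unfolding E_def using D R by (subst finite_measure_Union) auto
  have "(\<lambda>n. prob (E n)) \<longlonglongrightarrow> prob (\<Inter>n. E n)"
    using E by (intro finite_Lim_measure_decseq) auto
  moreover have "(\<lambda>n. t + (1 - t) / 2 ^ n) \<longlonglongrightarrow> t + 0"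
    by (intro tendsto_add tendsto_const LIMSEQ_divide_realpow_zero) auto
  ultimately have "prob (\<Inter>n. E n) = t"
    using LIMSEQ_unique unfolding prob_E by fastforce
  then have "\<mu> (\<Inter>n. E n) = g t"
    using g_prob[of "\<Inter>n. E n"] E(2) by auto
  moreover have "\<mu> (E n) = g (t + (1 - t) / 2 ^ n)" for n
    using g_prob[OF E(2)] prob_E by metis
  ultimately show ?thesis
    using continuous_capacity_decseq[OF \<mu>_continuous_capacity _ E(1)] sets_subset[OF E(2)] by simp
qed

lemma g_mono: "s \<in> {0..1} \<Longrightarrow> t \<in> {0..1} \<Longrightarrow> s \<le> t \<Longrightarrow> g s \<le> g t"
  using strict_mono_on_leD[OF g_strict_mono] .

text \<open>For a monotone function, convergence along one sequence on each side suffices: a single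
  pair of points brackets all values in between.\<close>

lemma g_continuous: "continuous_on {0..1} g"
  unfolding continuous_on_iff
proof (intro ballI allI impI)
  fix t e :: real assume t: "t \<in> {0..1}" and "0 < e"
  have "\<forall>\<^sub>F n in sequentially. g (t - t / 2 ^ n) > g t - e \<and> g (t + (1 - t) / 2 ^ n) < g t + e"
    using order_tendstoD(1)[OF g_left[OF t], of "g t - e"] order_tendstoD(2)[OF g_right[OF t], of "g t + e"] \<open>0 < e\<close>
    by (intro eventually_conj) auto
  then obtain n where n: "g (t - t / 2 ^ n) > g t - e" "g (t + (1 - t) / 2 ^ n) < g t + e"
    by (auto simp: eventually_sequentially)
  have in01: "t - t / 2 ^ n \<in> {0..1}" "t + (1 - t) / 2 ^ n \<in> {0..1}"
  proof -
    have "t / 2 ^ n \<le> t" "0 \<le> t / 2 ^ n" "(1 - t) / 2 ^ n \<le> 1 - t" "0 \<le> (1 - t) / 2 ^ n"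
      using t by (auto simp: divide_le_eq mult_le_cancel_left1)
    then show "t - t / 2 ^ n \<in> {0..1}" "t + (1 - t) / 2 ^ n \<in> {0..1}"
      using t by auto
  qed
  \<comment> \<open>At an endpoint the bracketing point on the outer side coincides with
    \<open>t\<close>. The radius 1 replaces the zero distance there, because the interval has no
    other point on that side.\<close>
  define d where "d = min (if t = 0 then 1 else t / 2 ^ n) (if t = 1 then 1 else (1 - t) / 2 ^ n)"
  have "0 < d"
    using t by (auto simp: d_def)
  moreover have "dist (g s) (g t) < e" if s: "s \<in> {0..1}" "dist s t < d" for s
  proof (cases "s \<le> t")
    case True
    have "g s > g t - e"
    proof (cases "t = 0")
      case False
      then have "t - t / 2 ^ n \<le> s"
        using s True by (auto simp: d_def dist_real_def)
      then show ?thesis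
        using g_mono[OF in01(1) s(1)] n(1) by simp
    qed (use True s \<open>0 < e\<close> in simp)
    then show ?thesis
      using g_mono[OF s(1) t True] by (simp add: dist_real_def)
  next
    case False
    then have "t \<noteq> 1" using s by auto
    then have "s \<le> t + (1 - t) / 2 ^ n"
      using s False by (auto simp: d_def dist_real_def)
    then have "g s < g t + e"
      using g_mono[OF s(1) in01(2)] n(2) by simp
    then show ?thesis
      using g_mono[OF t s(1)] False by (simp add: dist_real_def)
  qed
  ultimately show "\<exists>d>0. \<forall>s\<in>{0..1}. dist s t < d \<longrightarrow> dist (g s) (g t) < e"
    by blast
qed

lemma g_0: "g 0 = 0" and g_1: "g 1 = 1"
  using g_prob[of "{}"] g_prob[OF sets.top] continuous_capacity_capacity[OF \<mu>_continuous_capacity]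
  unfolding prob_space by (auto simp: capacity_def space_eq)

lemma g_distortion: "distortion_function g"
  using g_mono[of 0] g_mono[of _ 1] g_mono g_0 g_1
  by (auto simp: distortion_function_def mono_on_def)

section \<open>The inverse distortion and the resulting representation\<close>

definition h :: "real \<Rightarrow> real" where
  "h = the_inv_into {0..1} g"

lemma g_image: "g ` {0..1} = {0..1}"
proof
  show "g ` {0..1} \<subseteq> {0..1}"
    using g_distortion by (auto simp: distortion_function_def)
  show "{0..1} \<subseteq> g ` {0..1}"
    using IVT'[of g 0 _ 1] g_continuous by (fastforce simp: g_0 g_1)
qed

lemma g_inj: "inj_on g {0..1}"
  using g_strict_mono by (rule strict_mono_on_imp_inj_on)

lemma h_g: "t \<in> {0..1} \<Longrightarrow> h (g t) = t"
  unfolding h_def by (rule the_inv_into_f_f[OF g_inj])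

lemma g_h: "y \<in> {0..1} \<Longrightarrow> g (h y) = y"
  unfolding h_def by (rule f_the_inv_into_f[OF g_inj]) (simp add: g_image)

lemma h_distortion: "distortion_function h"
  unfolding distortion_function_def
proof (intro conjI funcsetI mono_onI)
  show h: "h y \<in> {0..1}" if "y \<in> {0..1}" for y
  proof -
    have "y \<in> g ` {0..1}"
      using that by (simp only: g_image)
    then obtain t where "t \<in> {0..1}" "y = g t"
      by blast
    then show ?thesis using h_g[of t] by metis
  qed
  \<comment> \<open>If \<open>h y < h x\<close>, applying the strictly increasing \<open>g\<close>
    would give \<open>y < x\<close>.\<close>
  show "h x \<le> h y" if "x \<in> {0..1}" "y \<in> {0..1}" "x \<le> y" for x y
    using strict_mono_onD[OF g_strict_mono h[OF that(2)] h[OF that(1)]] that g_h by force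
  show "h 0 = 0" "h 1 = 1"
    using h_g[of 0] h_g[of 1] by (simp_all add: g_0 g_1)
qed

lemma h_continuous: "continuous_on {0..1} h"
  using continuous_on_inv[OF g_continuous compact_Icc, of h] h_g by (simp add: g_image)

text \<open>On measurable sets \<open>g\<close> undoes \<open>h\<close>, so the distorted capacity
  is \<open>\<mu>\<close> and its integral is \<open>ce\<close>. Risk conformity holds because
  \<open>\<mu>\<close> equals \<open>g\<close> of the probability on events of \<open>P\<close> and
  \<open>h\<close> inverts \<open>g\<close>.\<close>

lemma representation: "choquet_representation M P pref g (h \<circ> \<mu>)"
proof -
  have \<mu>: "g (h (\<mu> A)) = \<mu> A" if "A \<in> sets M" for A
    using capacity_bounds[OF continuous_capacity_capacity[OF \<mu>_continuous_capacity] that] by (intro g_h) auto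
  have "choquet_integral M (g \<circ> (h \<circ> \<mu>)) X = ce X" if "X \<in> acts M" for X
    using sets_greater[OF acts_measurable[OF that]] by (simp add: ce_eq_choquet[OF that] choquet_integral_def \<mu>)
  then have "\<forall>X\<in>acts M. \<forall>Y\<in>acts M. pref X Y \<longleftrightarrow>
      choquet_integral M (g \<circ> (h \<circ> \<mu>)) X \<ge> choquet_integral M (g \<circ> (h \<circ> \<mu>)) Y"
    by (simp add: pref_iff_ce)
  moreover have "risk_conforming P (h \<circ> \<mu>)"
    unfolding risk_conforming_def using g_prob h_g prob_le_1 by (simp flip: g_prob)
  moreover have "continuous_capacity M (h \<circ> \<mu>)"
    by (rule distorted_continuous_capacity[OF h_distortion h_continuous \<mu>_continuous_capacity])
  ultimately show ?thesis
    unfolding choquet_representation_def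
    using g_distortion g_strict_mono g_continuous by blast
qed

end

section \<open>Equivalence, uniqueness and identification of the capacity\<close>

theorem theorem7:
  fixes M P :: "'a measure" and pref :: "('a \<Rightarrow> real) \<Rightarrow> ('a \<Rightarrow> real) \<Rightarrow> bool"
  assumes "prob_space P"
    and "subalgebra M P"
    and "atomless P"
    and "preference_relation M pref"
  shows "((axiom_RC P pref \<and> axiom_M M pref \<and> axiom_SRM P pref \<and> axiom_C M pref \<and> axiom_CI M pref)
            \<longleftrightarrow> (\<exists>g \<nu>. choquet_representation M P pref g \<nu>))
       \<and> (\<forall>g \<nu> g' \<nu>'. choquet_representation M P pref g \<nu> \<and> choquet_representation M P pref g' \<nu>' \<longrightarrow>
            (\<forall>t\<in>{0..1}. g t = g' t) \<and> (\<forall>A\<in>sets M. \<nu> A = \<nu>' A))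
       \<and> (\<forall>g \<nu>. choquet_representation M P pref g \<nu> \<longrightarrow>
            matching_probability M P pref \<nu> \<and>
            (\<forall>\<mu>. matching_probability M P pref \<mu> \<longrightarrow> (\<forall>A\<in>sets M. \<mu> A = \<nu> A)))"
proof (intro conjI iffI allI impI ballI; (elim conjE exE)?)
  assume "axiom_RC P pref" "axiom_M M pref" "axiom_SRM P pref" "axiom_C M pref" "axiom_CI M pref"
  with assms interpret choquet_axioms P M pref
    by (simp add: choquet_axioms_def choquet_axioms_axioms_def)
  show "\<exists>g \<nu>. choquet_representation M P pref g \<nu>"
    using representation by blast
next
  fix g \<nu> assume "choquet_representation M P pref g \<nu>"
  note rep = assms(1,2) this
  show "axiom_RC P pref" "axiom_M M pref" "axiom_SRM P pref" "axiom_C M pref" "axiom_CI M pref"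
    using representation_RC[OF rep] representation_M[OF rep] representation_SRM[OF rep]
      representation_C[OF rep] representation_CI[OF rep] by this
  show "matching_probability M P pref \<nu>"
    by (rule representation_matching[OF rep assms(3)])
  show "\<mu> A = \<nu> A" if "matching_probability M P pref \<mu>" "A \<in> sets M" for \<mu> A
    by (rule representation_matching_unique[OF rep that])
next
  fix g \<nu> g' \<nu>'
  assume "choquet_representation M P pref g \<nu>" "choquet_representation M P pref g' \<nu>'"
  note unique = representation_unique[OF assms(1-3) this]
  show "g t = g' t" if "t \<in> {0..1}" for t by (rule unique(1)[OF that])
  show "\<nu> A = \<nu>' A" if "A \<in> sets M" for A by (rule unique(2)[OF that])
qed

end
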